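(* Let $H$ be a Hardy field and let $E$ be a differentially algebraic Hardy field extension of $H$ such that $\exp\big(E(x)\big)\subseteq E(x)$. Then $\operatorname{cf}(E)\le\operatorname{cf}(H)$, and if moreover $\exp\big(H(x)\big)\subseteq H(x)$, then $\operatorname{cf}(E)=\operatorname{cf}(H)$.
   Context: $\mathcal C^{<\infty}$ is the differential ring of germs at $+\infty$ of real functions that are $n$ times continuously differentiable for every $n$; a Hardy field is a subfield of $\mathcal C^{<\infty}$ closed under the derivation, totally ordered by $f<g$ iff $f(t)<g(t)$ eventually. $x$ denotes the germ of the identity function; for a Hardy field $F$, $F(x)$ is the (Hardy) field generated by $F$ and $x$, and $\exp(F(x))=\{e^f: f\in F(x)\}$. $E$ is differentially algebraic over $H$ if every element of $E$ satisfies a nonzero differential polynomial equation over $H$. $\operatorname{cf}(S)$ denotes the cofinality of a totally ordered set $S$ (the least ordinal isomorphic to a cofinal subset of $S$). *)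

theory Defs
  imports "HOL-Analysis.Analysis" "HOL-Library.Poly_Mapping"
begin

no_notation Set_Algebras.elt_set_eq (infix "=o" 50)
unbundle cardinal_syntax

section \<open>Germs at infinity\<close>

quotient_type germ = "real \<Rightarrow> real" / "\<lambda>f g. \<forall>\<^sub>F t in at_top. f t = g t"
  proof (rule equivpI)
  show "transp (\<lambda>f g :: real \<Rightarrow> real. \<forall>\<^sub>F t in at_top. f t = g t)"
    by (rule transpI, erule (1) eventually_elim2, simp)
qed (auto intro!: reflpI sympI elim: eventually_mono)

instantiation germ :: comm_ring_1
begin

lift_definition zero_germ :: germ is "\<lambda>_. 0" .

lift_definition one_germ :: germ is "\<lambda>_. 1" .

lift_definition plus_germ :: "germ \<Rightarrow> germ \<Rightarrow> germ" is "\<lambda>f g t. f t + g t"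
  by (erule (1) eventually_elim2, simp)

lift_definition uminus_germ :: "germ \<Rightarrow> germ" is "\<lambda>f t. - f t"
  by (auto elim: eventually_mono)

lift_definition minus_germ :: "germ \<Rightarrow> germ \<Rightarrow> germ" is "\<lambda>f g t. f t - g t"
  by (erule (1) eventually_elim2, simp)

lift_definition times_germ :: "germ \<Rightarrow> germ \<Rightarrow> germ" is "\<lambda>f g t. f t * g t"
  by (erule (1) eventually_elim2, simp)

instance
  by standard (transfer; simp add: algebra_simps)+

end

lift_definition germ_x :: germ is "\<lambda>t. t" .

lift_definition germ_exp :: "germ \<Rightarrow> germ" is "\<lambda>f t. exp (f t)"
  by (auto elim: eventually_mono)

lift_definition germ_less :: "germ \<Rightarrow> germ \<Rightarrow> bool"
  is "\<lambda>f g. \<forall>\<^sub>F t in at_top. f t < g t"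
  by (rule eventually_subst, erule (1) eventually_elim2, simp)

lemma eventually_deriv_cong:
  fixes f g :: "real \<Rightarrow> real"
  assumes "\<forall>\<^sub>F t in at_top. f t = g t"
  shows "\<forall>\<^sub>F t in at_top. deriv f t = deriv g t"
proof -
  obtain b where b: "\<And>t. t > b \<Longrightarrow> f t = g t"
    using assms by (auto simp: eventually_at_top_dense)
  have "deriv f t = deriv g t" if "t > b" for t
  proof (rule deriv_cong_ev)
    show "\<forall>\<^sub>F s in nhds t. f s = g s"
      using that b by (intro eventually_nhds_in_open[THEN eventually_mono, of "{b<..}"]) auto
  qed auto
  then show ?thesis
    by (auto simp: eventually_at_top_dense)
qed

text \<open>
  \<open>deriv\<close> is a total function, so \<open>germ_deriv\<close> is the derivation only on germs
  of eventually differentiable functions.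
\<close>

lift_definition germ_deriv :: "germ \<Rightarrow> germ" is deriv
  by (rule eventually_deriv_cong)

text \<open>\<open>S\<close> is meant to be open.\<close>

definition cont_diff_on :: "nat \<Rightarrow> (real \<Rightarrow> real) \<Rightarrow> real set \<Rightarrow> bool" where
  "cont_diff_on n f S \<longleftrightarrow>
     (\<forall>k<n. \<forall>t\<in>S. (deriv ^^ k) f differentiable (at t)) \<and>
     (\<forall>k\<le>n. continuous_on S ((deriv ^^ k) f))"

lemma cont_diff_on_cong:
  assumes "cont_diff_on n f {a<..}" and eq: "\<And>t. t > a \<Longrightarrow> f t = g t"
  shows "cont_diff_on n g {a<..}"
proof -
  have ev: "\<forall>\<^sub>F s in nhds t. f s = g s" if "t > a" for t
    using that eq by (intro eventually_nhds_in_open[THEN eventually_mono, of "{a<..}"]) auto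
  have eqd: "(deriv ^^ k) f t = (deriv ^^ k) g t" if "t > a" for k t
    using ev[OF that] by (rule higher_deriv_cong_ev) simp
  have "(deriv ^^ k) g differentiable (at t)"
    if "(deriv ^^ k) f differentiable (at t)" "t > a" for k t
    using that(1) unfolding differentiable_def
    by (meson eqd has_derivative_transform_within_open[of _ _ t UNIV "{a<..}"]
          open_greaterThan greaterThan_iff that(2))
  moreover have "continuous_on {a<..} ((deriv ^^ k) f) = continuous_on {a<..} ((deriv ^^ k) g)" for k
    by (rule continuous_on_cong) (auto simp: eqd)
  ultimately show ?thesis
    using assms(1) unfolding cont_diff_on_def by auto
qed

lemma cont_diff_on_mono: "cont_diff_on n f T \<Longrightarrow> S \<subseteq> T \<Longrightarrow> cont_diff_on n f S"
  unfolding cont_diff_on_def by (meson continuous_on_subset subsetD)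

text \<open>
  Membership in \<open>\<C>\<^sup><\<^sup>\<infinity>\<close>.  The half-line on which a representative is \<open>n\<close> times
  continuously differentiable may depend on \<open>n\<close>, so such a germ need not have
  a smooth representative.
\<close>

lift_definition in_C_inf :: "germ \<Rightarrow> bool"
  is "\<lambda>f. \<forall>n. \<exists>a. cont_diff_on n f {a<..}"
proof -
  have *: "\<exists>a. cont_diff_on n g {a<..}"
    if ev: "\<forall>\<^sub>F t in at_top. f t = g t" and cd: "cont_diff_on n f {a<..}"
    for f g :: "real \<Rightarrow> real" and n a
  proof -
    obtain b where b: "\<And>t. t > b \<Longrightarrow> f t = g t"
      using ev by (auto simp: eventually_at_top_dense)
    have "cont_diff_on n f {max a b<..}"
      using cd by (rule cont_diff_on_mono) auto
    then have "cont_diff_on n g {max a b<..}"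
      by (rule cont_diff_on_cong) (use b in auto)
    then show ?thesis by blast
  qed
  fix f g :: "real \<Rightarrow> real"
  assume fg: "\<forall>\<^sub>F t in at_top. f t = g t"
  then have gf: "\<forall>\<^sub>F t in at_top. g t = f t"
    by (auto elim: eventually_mono)
  show "(\<forall>n. \<exists>a. cont_diff_on n f {a<..}) = (\<forall>n. \<exists>a. cont_diff_on n g {a<..})"
    using *[OF fg] *[OF gf] by blast
qed

section \<open>Hardy fields\<close>

definition C_inf_subfield :: "germ set \<Rightarrow> bool" where
  "C_inf_subfield K \<longleftrightarrow>
     (\<forall>f\<in>K. in_C_inf f) \<and> 0 \<in> K \<and> 1 \<in> K \<and>
     (\<forall>f\<in>K. \<forall>g\<in>K. f + g \<in> K) \<and> (\<forall>f\<in>K. - f \<in> K) \<and>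
     (\<forall>f\<in>K. \<forall>g\<in>K. f * g \<in> K) \<and> (\<forall>f\<in>K. f \<noteq> 0 \<longrightarrow> (\<exists>g\<in>K. f * g = 1))"

definition hardy_field :: "germ set \<Rightarrow> bool" where
  "hardy_field H \<longleftrightarrow> C_inf_subfield H \<and> (\<forall>f\<in>H. germ_deriv f \<in> H)"

definition germ_order :: "germ set \<Rightarrow> germ rel" where
  "germ_order S = {(f, g). f \<in> S \<and> g \<in> S \<and> (germ_less f g \<or> f = g)}"

lemma Field_germ_order [simp]: "Field (germ_order S) = S"
  by (auto simp: germ_order_def Field_def)

text \<open>
  Totality of the ordering is not part of the definition of a Hardy field: it
  follows from the intermediate value theorem.
\<close>

lemma C_inf_subfield_trichotomy:
  assumes K: "C_inf_subfield K" and h: "h \<in> K" and "h \<noteq> 0"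
  shows "germ_less 0 h \<or> germ_less h 0"
proof -
  have "\<forall>f\<in>K. f \<noteq> 0 \<longrightarrow> (\<exists>g\<in>K. f * g = 1)" "\<forall>f\<in>K. in_C_inf f"
    using K by (simp_all add: C_inf_subfield_def)
  then obtain k where "h * k = 1" and "in_C_inf h"
    using h \<open>h \<noteq> 0\<close> by metis
  then show ?thesis
  proof (transfer)
    fix f g :: "real \<Rightarrow> real"
    assume "\<forall>\<^sub>F t in at_top. f t * g t = 1"
    then obtain b where b: "\<And>t. t > b \<Longrightarrow> f t * g t = 1"
      by (auto simp: eventually_at_top_dense)
    assume "\<forall>n. \<exists>a. cont_diff_on n f {a<..}"
    then obtain a where "cont_diff_on 0 f {a<..}"
      by blast
    then have a: "continuous_on {a<..} f"
      by (auto simp: cont_diff_on_def)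
    define c where "c = max a b"
    have conn: "connected (f ` {c<..})"
      by (rule connected_continuous_image[OF continuous_on_subset[OF a]]) (auto simp: c_def)
    have nz: "f t \<noteq> 0" if "t > c" for t
      using b[of t] that by (auto simp: c_def)
    have "(\<forall>t>c. 0 < f t) \<or> (\<forall>t>c. f t < 0)"
    proof (rule ccontr)
      assume "\<not> ?thesis"
      then obtain s t where st: "s > c" "t > c" "f s \<le> 0" "0 \<le> f t"
        by (auto simp: not_less)
      have "0 \<in> f ` {c<..}"
        by (rule connectedD_interval[OF conn, of "f s" "f t"]) (use st in simp_all)
      with nz show False
        by auto
    qed
    then show "(\<forall>\<^sub>F t in at_top. 0 < f t) \<or> (\<forall>\<^sub>F t in at_top. f t < 0)"
      by (auto simp: eventually_at_top_dense)
  qed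
qed

lemma germ_less_diff: "germ_less f g \<longleftrightarrow> germ_less 0 (g - f)"
  "germ_less f g \<longleftrightarrow> germ_less (f - g) 0"
  by (transfer; simp)+

lemma germ_less_irrefl: "\<not> germ_less f f"
  by transfer simp

lemma germ_less_trans: "germ_less f g \<Longrightarrow> germ_less g h \<Longrightarrow> germ_less f h"
  by (transfer, erule (1) eventually_elim2, simp)

lemma Linear_order_germ_order:
  assumes "hardy_field H"
  shows "Linear_order (germ_order H)"
proof -
  have K: "C_inf_subfield H"
    using assms by (simp add: hardy_field_def)
  have tot: "germ_less f g \<or> germ_less g f" if "f \<in> H" "g \<in> H" "f \<noteq> g" for f g
  proof -
    have "\<forall>f\<in>H. \<forall>g\<in>H. f + g \<in> H" "\<forall>f\<in>H. - f \<in> H"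
      using K by (simp_all add: C_inf_subfield_def)
    then have "g - f \<in> H"
      using that by (metis add_uminus_conv_diff)
    then have "germ_less 0 (g - f) \<or> germ_less (g - f) 0"
      using C_inf_subfield_trichotomy[OF K, of "g - f"] that by simp
    then show ?thesis
      by (metis germ_less_diff)
  qed
  have "refl_on H (germ_order H)"
    by (simp add: refl_on_def germ_order_def)
  moreover have "trans (germ_order H)"
    unfolding trans_def germ_order_def using germ_less_trans by blast
  moreover have "antisym (germ_order H)"
    unfolding antisym_def germ_order_def using germ_less_trans germ_less_irrefl by blast
  moreover have "total_on H (germ_order H)"
    using tot by (auto simp: total_on_def germ_order_def)
  moreover have "germ_order H \<subseteq> H \<times> H"
    by (auto simp: germ_order_def)
  ultimately show ?thesis
    by (simp add: order_on_defs)
qed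

text \<open>
  \<open>adjoin_x F\<close> is the field \<open>F(x)\<close>.  For a Hardy field \<open>F\<close> the intersection
  is over a nonempty family, since \<open>F(x)\<close> exists inside \<open>\<C>\<^sup><\<^sup>\<infinity>\<close>.
\<close>

definition adjoin_x :: "germ set \<Rightarrow> germ set" where
  "adjoin_x F = \<Inter> {K. C_inf_subfield K \<and> insert germ_x F \<subseteq> K}"

section \<open>Differentially algebraic extensions\<close>

text \<open>
  A differential polynomial in one indeterminate \<open>Y\<close> is a polynomial in the
  variables \<open>Y, Y', Y'', \<dots>\<close>.  A monomial \<open>m :: nat \<Rightarrow>\<^sub>0 nat\<close> stands for the
  product of the \<open>(Y\<^sup>(\<^sup>i\<^sup>))\<^sup>m\<^sup>i\<close>.
\<close>

type_synonym diff_poly = "(nat \<Rightarrow>\<^sub>0 nat) \<Rightarrow>\<^sub>0 germ"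

definition diff_poly_eval :: "diff_poly \<Rightarrow> germ \<Rightarrow> germ" where
  "diff_poly_eval P y =
     (\<Sum>m\<in>Poly_Mapping.keys P. Poly_Mapping.lookup P m *
        (\<Prod>i\<in>Poly_Mapping.keys m. ((germ_deriv ^^ i) y) ^ Poly_Mapping.lookup m i))"

definition diff_algebraic_over :: "germ set \<Rightarrow> germ set \<Rightarrow> bool" where
  "diff_algebraic_over E H \<longleftrightarrow>
     (\<forall>y\<in>E. \<exists>P :: diff_poly.
        P \<noteq> 0 \<and> (\<forall>m. Poly_Mapping.lookup P m \<in> H) \<and> diff_poly_eval P y = 0)"

section \<open>Cofinality\<close>

text \<open>
  As in the library, ordinals are represented by well-orders up to isomorphism
  (\<open>=o\<close>) and compared by \<open>\<le>o\<close>.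
  Unlike the library's \<open>cofinal\<close>, a cofinal subset need not contain strictly
  larger elements, so that a largest element is cofinal.
\<close>

definition cofinal_subset :: "'a rel \<Rightarrow> 'a set \<Rightarrow> bool" where
  "cofinal_subset r A \<longleftrightarrow> A \<subseteq> Field r \<and> (\<forall>x\<in>Field r. \<exists>a\<in>A. (x, a) \<in> r)"

definition is_cofinality :: "'a rel \<Rightarrow> 'a rel \<Rightarrow> bool" where
  "is_cofinality r \<kappa> \<longleftrightarrow>
     Well_order \<kappa> \<and> (\<exists>A. cofinal_subset r A \<and> \<kappa> =o Restr r A) \<and>
     (\<forall>\<alpha> :: 'a rel. Well_order \<alpha> \<and> (\<exists>B. cofinal_subset r B \<and> \<alpha> =o Restr r B) \<longrightarrow> \<kappa> \<le>o \<alpha>)"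

definition cofinality :: "'a rel \<Rightarrow> 'a rel" where
  "cofinality r = (SOME \<kappa>. is_cofinality r \<kappa>)"

lemma is_cofinality_unique:
  assumes "is_cofinality r \<kappa>" and "is_cofinality r \<mu>"
  shows "\<kappa> =o \<mu>"
proof -
  have "\<kappa> \<le>o \<mu>" "\<mu> \<le>o \<kappa>"
    using assms unfolding is_cofinality_def by blast+
  then show ?thesis
    by (simp add: ordIso_iff_ordLeq)
qed

lemma ex_well_ordered_cofinal_subset:
  assumes r: "Linear_order r"
  shows "\<exists>A. cofinal_subset r A \<and> Well_order (Restr r A)"
proof -
  obtain w where wo: "well_order_on (Field r) w"
    using well_order_on by blast
  have wf: "wf (w - Id)" and tot: "total_on (Field r) w"
    using wo by (auto simp: well_order_on_def linear_order_on_def)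
  have rr: "refl_on (Field r) r" "trans r" "antisym r" "total_on (Field r) r"
    using r by (auto simp: order_on_defs)
  define A where "A = {a \<in> Field r. \<forall>b. (b, a) \<in> w - Id \<longrightarrow> (b, a) \<in> r - Id}"
  have sub: "A \<subseteq> Field r"
    by (auto simp: A_def)
  have "\<exists>a\<in>A. (x, a) \<in> r" if x: "x \<in> Field r" for x
  proof -
    have "(x, x) \<in> r"
      using rr(1) x by (auto simp: refl_on_def)
    then have "x \<in> {y. (x, y) \<in> r}"
      by simp
    then obtain y where "y \<in> {y. (x, y) \<in> r}"
      and "\<And>b. (b, y) \<in> w - Id \<Longrightarrow> b \<notin> {y. (x, y) \<in> r}"
      using wfE_min[OF wf] by metis
    then have y: "(x, y) \<in> r" and miny: "\<And>b. (b, y) \<in> w - Id \<Longrightarrow> (x, b) \<notin> r"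
      by simp_all
    have yF: "y \<in> Field r"
      using y by (auto simp: Field_def)
    have "(b, y) \<in> r - Id" if b: "(b, y) \<in> w - Id" for b
    proof -
      have bF: "b \<in> Field r"
        using b wo well_order_on_Field[OF wo] by (auto simp: Field_def)
      have "(x, b) \<notin> r"
        using miny b by blast
      then have "(b, x) \<in> r"
        using rr(4) x bF \<open>(x, x) \<in> r\<close> by (metis total_on_def)
      then show ?thesis
        using y b rr(2) by (auto dest: transD)
    qed
    then show ?thesis
      using y yF by (auto simp: A_def)
  qed
  then have cof: "cofinal_subset r A"
    using sub by (auto simp: cofinal_subset_def)
  have "Restr r A - Id \<subseteq> w - Id"
  proof
    fix p assume p: "p \<in> Restr r A - Id"
    obtain a b where ab: "p = (a, b)" by (cases p)
    have "(a, b) \<in> w"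
    proof (rule ccontr)
      assume "(a, b) \<notin> w"
      then have "(b, a) \<in> w - Id"
        using p ab tot sub by (auto simp: total_on_def)
      then have "(b, a) \<in> r - Id"
        using p ab by (auto simp: A_def)
      then show False
        using p ab rr(3) by (auto dest: antisymD)
    qed
    then show "p \<in> w - Id"
      using p ab by auto
  qed
  then have "wf (Restr r A - Id)"
    using wf wf_subset by blast
  then have "Well_order (Restr r A)"
    using Linear_order_Restr[OF r, of A] by (simp add: well_order_on_def)
  then show ?thesis
    using cof by blast
qed

lemma is_cofinality_cofinality:
  fixes r :: "'a rel"
  assumes "Linear_order r"
  shows "is_cofinality r (cofinality r)"
proof -
  define R where "R = {\<alpha> :: 'a rel. Well_order \<alpha> \<and> (\<exists>B. cofinal_subset r B \<and> \<alpha> =o Restr r B)}"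
  have "R \<noteq> {}"
    using ex_well_ordered_cofinal_subset[OF assms] ordIso_reflexive by (auto simp: R_def)
  moreover have "\<forall>\<alpha>\<in>R. Well_order \<alpha>"
    by (simp add: R_def)
  ultimately obtain \<kappa> where "\<kappa> \<in> R" "\<forall>\<alpha>\<in>R. \<kappa> \<le>o \<alpha>"
    using exists_minim_Well_order by blast
  then have "is_cofinality r \<kappa>"
    by (auto simp: is_cofinality_def R_def)
  then show ?thesis
    unfolding cofinality_def by (rule someI)
qed

definition cf :: "germ set \<Rightarrow> germ rel" where
  "cf S = cofinality (germ_order S)"

end

theory Submission
  imports Defs "HOL-Real_Asymp.Real_Asymp" "HOL-Computational_Algebra.Polynomial"
begin

text \<open>
  Every \<open>g \<in> E\<close> lies below some iterated exponential \<open>exp\<^sub>n(h)\<close> with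
  \<open>h \<in> H \<union> {x}\<close>.  Otherwise \<open>g\<close> exceeds all of these, hence so does its logarithmic derivative
  \<open>z = g'/g\<close>, and \<open>g\<close> exceeds all powers of \<open>z\<close>.  Substituting \<open>g\<^sup>(\<^sup>i\<^sup>) = g R\<^sub>i(z, z', \<dots>)\<close> turns a
  differential polynomial in \<open>g\<close> into an ordinary polynomial in \<open>g\<close> whose coefficients are
  differential polynomials in \<open>z\<close> of smaller order; by induction on the order its leading coefficient
  is not too small, so that the leading term dominates and \<open>P(g) \<noteq> 0\<close> for all \<open>P \<noteq> 0\<close> over \<open>H\<close>.

  On the other hand, a Hardy field \<open>K\<close> with \<open>exp(K(x)) \<subseteq> K(x)\<close> is cofinal in \<open>K(x)\<close>: a nonzero monic
  \<open>u \<in> K[x]\<close> cannot be smaller than \<open>K\<^sup>>\<^sup>0\<close> because its derivative has lower degree, hence would not be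
  small, and \<open>K < x\<close> would make the powers of \<open>x\<close> cofinal in \<open>K(x)\<close>, which contains \<open>exp(x)\<close>.
  Thus all \<open>exp\<^sub>n(h)\<close> are bounded in \<open>E\<close> (in \<open>H\<close>, for the second claim), and a cofinal subset \<open>A\<close> of \<open>H\<close>
  yields one of \<open>E\<close> of cardinality at most that of \<open>A \<times> \<nat>\<close>.
\<close>

section \<open>Germs of infinitely differentiable functions\<close>

text \<open>Peeling off the first derivative, rather than the last, allows induction on the order
  for sums, products and reciprocals.\<close>

lemma cont_diff_on_Suc:
  "cont_diff_on (Suc n) f S \<longleftrightarrow> (\<forall>t\<in>S. f differentiable (at t)) \<and> cont_diff_on n (deriv f) S"
  (is "?L = ?R")
proof -
  have sh: "(deriv ^^ k) (deriv f) = (deriv ^^ Suc k) f" for k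
    by (simp add: funpow_swap1)
  show ?thesis
  proof
    assume L: ?L
    have "f differentiable (at t)" if "t \<in> S" for t
      using L that unfolding cont_diff_on_def by (metis funpow_0 zero_less_Suc)
    then show ?R
      using L unfolding cont_diff_on_def sh by auto
  next
    assume R: ?R
    have c0: "continuous_on S f"
      using R by (meson continuous_at_imp_continuous_on differentiable_imp_continuous_within)
    show ?L
      unfolding cont_diff_on_def
    proof (intro conjI allI impI)
      fix k assume "k < Suc n"
      then show "\<forall>t\<in>S. (deriv ^^ k) f differentiable (at t)"
        using R unfolding cont_diff_on_def sh by (cases k) auto
    next
      fix k assume "k \<le> Suc n"
      then show "continuous_on S ((deriv ^^ k) f)"
        using R c0 unfolding cont_diff_on_def sh by (cases k) auto
    qed
  qed
qed

lemma cont_diff_on_0: "cont_diff_on 0 f S \<longleftrightarrow> continuous_on S f"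
  by (simp add: cont_diff_on_def)

lemma cont_diff_on_le: "cont_diff_on n f S \<Longrightarrow> m \<le> n \<Longrightarrow> cont_diff_on m f S"
  unfolding cont_diff_on_def by simp

lemma cont_diff_on_const: "cont_diff_on n (\<lambda>_. c) S"
  by (induction n arbitrary: c) (simp_all add: cont_diff_on_Suc cont_diff_on_0)

lemma cont_diff_on_ident: "cont_diff_on n (\<lambda>t. t) S"
  by (cases n) (simp_all add: cont_diff_on_Suc cont_diff_on_0 cont_diff_on_const)

lemma real_differentiable_DERIV:
  fixes f :: "real \<Rightarrow> real"
  shows "f differentiable (at t) \<Longrightarrow> (f has_real_derivative deriv f t) (at t)"
  by (simp add: DERIV_deriv_iff_real_differentiable)

lemma cont_diff_on_add:
  "cont_diff_on n f {a<..} \<Longrightarrow> cont_diff_on n g {a<..} \<Longrightarrow> cont_diff_on n (\<lambda>t. f t + g t) {a<..}"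
proof (induction n arbitrary: f g)
  case 0
  then show ?case by (auto simp: cont_diff_on_0 intro: continuous_intros)
next
  case (Suc n)
  \<comment> \<open>\<open>deriv\<close> is total but additive only where both functions are
    differentiable, hence the transfer by \<open>cont_diff_on_cong\<close> on the half-line.\<close>
  have d: "deriv f t + deriv g t = deriv (\<lambda>t. f t + g t) t" if "t > a" for t
  proof -
    have "(f has_real_derivative deriv f t) (at t)" "(g has_real_derivative deriv g t) (at t)"
      using Suc.prems that by (auto simp: cont_diff_on_Suc intro: real_differentiable_DERIV)
    from DERIV_add[OF this] show ?thesis
      by (simp add: DERIV_imp_deriv)
  qed
  have "cont_diff_on n (\<lambda>t. deriv f t + deriv g t) {a<..}"
    using Suc by (simp add: cont_diff_on_Suc)
  from cont_diff_on_cong[OF this d] show ?case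
    using Suc.prems by (auto simp: cont_diff_on_Suc)
qed

lemma cont_diff_on_mult:
  "cont_diff_on n f {a<..} \<Longrightarrow> cont_diff_on n g {a<..} \<Longrightarrow> cont_diff_on n (\<lambda>t. f t * g t) {a<..}"
proof (induction n arbitrary: f g)
  case 0
  then show ?case by (auto simp: cont_diff_on_0 intro: continuous_intros)
next
  case (Suc n)
  have d: "deriv f t * g t + f t * deriv g t = deriv (\<lambda>t. f t * g t) t" if "t > a" for t
  proof -
    have "(f has_real_derivative deriv f t) (at t)" "(g has_real_derivative deriv g t) (at t)"
      using Suc.prems that by (auto simp: cont_diff_on_Suc intro: real_differentiable_DERIV)
    from DERIV_mult[OF this] show ?thesis
      by (simp add: DERIV_imp_deriv algebra_simps)
  qed
  have "cont_diff_on n (\<lambda>t. deriv f t * g t + f t * deriv g t) {a<..}"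
    by (intro cont_diff_on_add Suc.IH)
       (use Suc.prems in \<open>auto simp: cont_diff_on_Suc[of n f] cont_diff_on_Suc[of n g]
          intro: cont_diff_on_le[of "Suc n"]\<close>)
  from cont_diff_on_cong[OF this d] show ?case
    using Suc.prems by (auto simp: cont_diff_on_Suc)
qed

lemma cont_diff_on_inverse:
  assumes "cont_diff_on n f {a<..}" and nz: "\<And>t. t > a \<Longrightarrow> f t \<noteq> 0"
  shows "cont_diff_on n (\<lambda>t. inverse (f t)) {a<..}"
  using assms(1)
proof (induction n)
  case 0
  then show ?case using nz by (auto simp: cont_diff_on_0 intro!: continuous_intros)
next
  case (Suc n)
  have D: "((\<lambda>t. inverse (f t)) has_real_derivative - 1 * deriv f t * inverse (f t) * inverse (f t)) (at t)"
    if "t > a" for t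
  proof -
    have "(f has_real_derivative deriv f t) (at t)"
      using Suc.prems that by (auto simp: cont_diff_on_Suc intro: real_differentiable_DERIV)
    from DERIV_inverse'[OF this nz[OF that]] show ?thesis
      by (simp add: algebra_simps)
  qed
  \<comment> \<open>The derivative of 1/f is a product containing 1/f again, whose regularity of
    order n is the induction hypothesis. Writing the sign as the factor \<open>- 1\<close> leaves
    only products.\<close>
  have "cont_diff_on n (\<lambda>t. inverse (f t)) {a<..}"
    using Suc by (meson cont_diff_on_le le_Suc_eq order_refl)
  then have "cont_diff_on n (\<lambda>t. - 1 * deriv f t * inverse (f t) * inverse (f t)) {a<..}"
    by (intro cont_diff_on_mult cont_diff_on_const) (use Suc.prems in \<open>auto simp: cont_diff_on_Suc\<close>)
  from cont_diff_on_cong[OF this DERIV_imp_deriv[OF D, symmetric]] show ?case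
    using D by (auto simp: cont_diff_on_Suc real_differentiable_def)
qed

lift_definition germ_const :: "real \<Rightarrow> germ" is "\<lambda>c _. c" .

text \<open>For arbitrary germs this is weaker than being smaller or equal as germs. Inside a Hardy
  field, where every nonzero difference has an eventual sign, the two notions agree.\<close>

lift_definition germ_le :: "germ \<Rightarrow> germ \<Rightarrow> bool"
  is "\<lambda>f g. \<forall>\<^sub>F t in at_top. f t \<le> g t"
  by (rule eventually_subst, erule (1) eventually_elim2, simp)

lift_definition germ_abs :: "germ \<Rightarrow> germ" is "\<lambda>f t. \<bar>f t\<bar>"
  by (auto elim: eventually_mono)

lift_definition germ_inverse :: "germ \<Rightarrow> germ" is "\<lambda>f t. inverse (f t)"
  by (auto elim: eventually_mono)

lemma of_nat_germ: "of_nat k = germ_const (real k)"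
proof (induction k)
  case 0
  show ?case by (simp, transfer, simp)
next
  case (Suc k)
  have "germ_const (real k) + 1 = germ_const (real (Suc k))"
    by transfer simp
  with Suc show ?case by (simp add: add.commute)
qed

section \<open>Closure of the ring of infinitely differentiable germs and rules for the
  derivation\<close>

lemma in_C_inf_const: "in_C_inf (germ_const c)"
  by transfer (simp add: cont_diff_on_const)

lemma in_C_inf_x: "in_C_inf germ_x"
  by transfer (simp add: cont_diff_on_ident)

lemma in_C_inf_add: "in_C_inf f \<Longrightarrow> in_C_inf g \<Longrightarrow> in_C_inf (f + g)"
proof transfer
  fix f g :: "real \<Rightarrow> real"
  assume *: "\<forall>n. \<exists>a. cont_diff_on n f {a<..}" "\<forall>n. \<exists>a. cont_diff_on n g {a<..}"
  show "\<forall>n. \<exists>a. cont_diff_on n (\<lambda>t. f t + g t) {a<..}"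
  proof
    fix n
    obtain a b where "cont_diff_on n f {a<..}" "cont_diff_on n g {b<..}"
      using * by blast
    then have "cont_diff_on n f {max a b<..}" "cont_diff_on n g {max a b<..}"
      by (auto elim!: cont_diff_on_mono)
    then show "\<exists>a. cont_diff_on n (\<lambda>t. f t + g t) {a<..}"
      by (blast intro: cont_diff_on_add)
  qed
qed

lemma in_C_inf_mult: "in_C_inf f \<Longrightarrow> in_C_inf g \<Longrightarrow> in_C_inf (f * g)"
proof transfer
  fix f g :: "real \<Rightarrow> real"
  assume *: "\<forall>n. \<exists>a. cont_diff_on n f {a<..}" "\<forall>n. \<exists>a. cont_diff_on n g {a<..}"
  show "\<forall>n. \<exists>a. cont_diff_on n (\<lambda>t. f t * g t) {a<..}"
  proof
    fix n
    obtain a b where "cont_diff_on n f {a<..}" "cont_diff_on n g {b<..}"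
      using * by blast
    then have "cont_diff_on n f {max a b<..}" "cont_diff_on n g {max a b<..}"
      by (auto elim!: cont_diff_on_mono)
    then show "\<exists>a. cont_diff_on n (\<lambda>t. f t * g t) {a<..}"
      by (blast intro: cont_diff_on_mult)
  qed
qed

lemma in_C_inf_uminus: "in_C_inf f \<Longrightarrow> in_C_inf (- f)"
proof -
  have "- f = germ_const (-1) * f"
    by transfer simp
  then show "in_C_inf f \<Longrightarrow> in_C_inf (- f)"
    by (simp add: in_C_inf_mult in_C_inf_const)
qed

lemma in_C_inf_inverse: "in_C_inf f \<Longrightarrow> f * g = 1 \<Longrightarrow> in_C_inf g"
proof transfer
  fix f g :: "real \<Rightarrow> real"
  assume *: "\<forall>n. \<exists>a. cont_diff_on n f {a<..}" and "\<forall>\<^sub>F t in at_top. f t * g t = 1"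
  then obtain b where b: "\<And>t. t > b \<Longrightarrow> f t * g t = 1"
    by (auto simp: eventually_at_top_dense)
  have nz: "f t \<noteq> 0" "inverse (f t) = g t" if "t > b" for t
    using b[OF that] by (auto intro: inverse_unique)
  show "\<forall>n. \<exists>a. cont_diff_on n g {a<..}"
  proof
    fix n
    obtain a where "cont_diff_on n f {a<..}"
      using * by blast
    then have "cont_diff_on n f {max a b<..}"
      by (auto elim!: cont_diff_on_mono)
    then have "cont_diff_on n (\<lambda>t. inverse (f t)) {max a b<..}"
      by (rule cont_diff_on_inverse) (simp add: nz)
    then have "cont_diff_on n g {max a b<..}"
      by (rule cont_diff_on_cong) (simp add: nz)
    then show "\<exists>a. cont_diff_on n g {a<..}" ..
  qed
qed

lemma C_inf_DERIV:
  assumes "\<forall>n. \<exists>a. cont_diff_on n f {a<..}"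
  shows "\<forall>\<^sub>F t in at_top. (f has_real_derivative deriv f t) (at t)"
proof -
  obtain a where "cont_diff_on (Suc 0) f {a<..}"
    using assms by blast
  then show ?thesis
    by (auto simp: eventually_at_top_dense cont_diff_on_Suc intro: real_differentiable_DERIV)
qed

lemma germ_deriv_const: "germ_deriv (germ_const c) = 0"
  by transfer simp

lemma germ_deriv_x: "germ_deriv germ_x = 1"
  by transfer simp

lemma germ_deriv_add:
  "in_C_inf f \<Longrightarrow> in_C_inf g \<Longrightarrow> germ_deriv (f + g) = germ_deriv f + germ_deriv g"
proof transfer
  fix f g :: "real \<Rightarrow> real"
  assume *: "\<forall>n. \<exists>a. cont_diff_on n f {a<..}" "\<forall>n. \<exists>a. cont_diff_on n g {a<..}"
  from *[THEN C_inf_DERIV]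
  show "\<forall>\<^sub>F t in at_top. deriv (\<lambda>t. f t + g t) t = deriv f t + deriv g t"
    by eventually_elim (rule DERIV_imp_deriv, rule DERIV_add)
qed

lemma germ_deriv_mult:
  "in_C_inf f \<Longrightarrow> in_C_inf g \<Longrightarrow> germ_deriv (f * g) = germ_deriv f * g + f * germ_deriv g"
proof transfer
  fix f g :: "real \<Rightarrow> real"
  assume *: "\<forall>n. \<exists>a. cont_diff_on n f {a<..}" "\<forall>n. \<exists>a. cont_diff_on n g {a<..}"
  from *[THEN C_inf_DERIV]
  show "\<forall>\<^sub>F t in at_top. deriv (\<lambda>t. f t * g t) t = deriv f t * g t + f t * deriv g t"
  proof eventually_elim
    case (elim t)
    from DERIV_mult[OF elim] show ?case
      by (simp add: DERIV_imp_deriv algebra_simps)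
  qed
qed

lemma germ_deriv_uminus: "in_C_inf f \<Longrightarrow> germ_deriv (- f) = - germ_deriv f"
proof -
  have *: "- g = germ_const (-1) * g" for g
    by transfer simp
  show "in_C_inf f \<Longrightarrow> germ_deriv (- f) = - germ_deriv f"
    by (simp add: * germ_deriv_mult in_C_inf_const germ_deriv_const)
qed

section \<open>Consequences of the sign and size of a derivative\<close>

lemma eventually_DERIV_nbhd:
  assumes "\<forall>\<^sub>F t in at_top. (f has_real_derivative f' t) (at t)" "\<forall>\<^sub>F t in at_top. P (t::real)"
  obtains a where "\<And>t. t \<ge> a \<Longrightarrow> (f has_real_derivative f' t) (at t)" "\<And>t. t \<ge> a \<Longrightarrow> P t"
  using eventually_conj[OF assms] by (auto simp: eventually_at_top_linorder)

lemma germ_deriv_0_imp_const: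
  "in_C_inf f \<Longrightarrow> germ_deriv f = 0 \<Longrightarrow> \<exists>c. f = germ_const c"
proof transfer
  fix f :: "real \<Rightarrow> real"
  assume *: "\<forall>n. \<exists>a. cont_diff_on n f {a<..}" "\<forall>\<^sub>F t in at_top. deriv f t = 0"
  from C_inf_DERIV[OF *(1)] *(2)
  have "\<forall>\<^sub>F t in at_top. (f has_real_derivative 0) (at t)"
    by eventually_elim simp
  then obtain a where a: "\<And>t. t \<ge> a \<Longrightarrow> (f has_real_derivative 0) (at t)"
    by (auto simp: eventually_at_top_linorder)
  have "f t = f a" if "t \<ge> a" for t
  proof (cases "t = a")
    case False
    moreover have "continuous_on {a..t} f"
      using a by (intro continuous_at_imp_continuous_on ballI DERIV_isCont) auto
    ultimately show ?thesis
      using DERIV_isconst2[of a t f t] a that by auto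
  qed simp
  then show "\<exists>c. \<forall>\<^sub>F t in at_top. f t = c"
    by (auto simp: eventually_at_top_linorder)
qed

text \<open>By the mean value theorem u falls at least linearly and cannot stay positive. Three
  later contradictions reduce to this one, with u a square root, a negative power or a reflection of
  the given function.\<close>

lemma positive_DERIV_le_neg_False:
  fixes u u' :: "real \<Rightarrow> real"
  assumes "\<forall>\<^sub>F t in at_top. 0 < u t"
    and "\<forall>\<^sub>F t in at_top. (u has_real_derivative u' t) (at t)"
    and "\<forall>\<^sub>F t in at_top. u' t \<le> - c" and "c > 0"
  shows False
proof -
  from eventually_DERIV_nbhd[OF assms(2) eventually_conj[OF assms(1,3)]]
  obtain a where a: "\<And>t. t \<ge> a \<Longrightarrow> (u has_real_derivative u' t) (at t)"
    "\<And>t. t \<ge> a \<Longrightarrow> 0 < u t" "\<And>t. t \<ge> a \<Longrightarrow> u' t \<le> - c"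
    by metis
  \<comment> \<open>At this distance from a the decrease is at least \<open>u a + c\<close>, so that
    \<open>u b \<le> - c\<close>.\<close>
  define b where "b = a + u a / c + 1"
  have ab: "a < b" using a(2)[of a] \<open>c > 0\<close> by (simp add: b_def add_pos_pos pos_add_strict)
  obtain s where "s > a" "s < b" "u b - u a = (b - a) * u' s"
    using MVT2[OF ab, of u u'] a(1) by auto
  moreover have "(b - a) * u' s \<le> (b - a) * (- c)"
    using ab a(3)[of s] \<open>s > a\<close> by (intro mult_left_mono) auto
  moreover have "(b - a) * (- c) = - u a - c"
    using \<open>c > 0\<close> by (simp add: b_def field_simps)
  ultimately show False
    using a(2)[of b] ab \<open>c > 0\<close> by simp
qed

text \<open>u is eventually strictly increasing. If it is positive somewhere, it stays above a
  positive constant; if never, strict monotonicity makes it negative. The constant is turned into an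
  integer factor because every subfield contains the integers.\<close>

lemma germ_deriv_pos_sign:
  "in_C_inf u \<Longrightarrow> germ_less 0 (germ_deriv u) \<Longrightarrow>
    (\<exists>k. germ_le 1 (germ_const (real k) * u)) \<or> germ_less u 0"
proof transfer
  fix u :: "real \<Rightarrow> real"
  assume *: "\<forall>n. \<exists>a. cont_diff_on n u {a<..}" "\<forall>\<^sub>F t in at_top. 0 < deriv u t"
  from eventually_DERIV_nbhd[OF C_inf_DERIV[OF *(1)] *(2)]
  obtain a where a: "\<And>t. t \<ge> a \<Longrightarrow> (u has_real_derivative deriv u t) (at t)"
    "\<And>t. t \<ge> a \<Longrightarrow> 0 < deriv u t"
    by metis
  have mono: "u s < u t" if "a \<le> s" "s < t" for s t
    by (rule DERIV_pos_imp_increasing[OF that(2)]) (meson a order_trans that(1))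
  show "(\<exists>k. \<forall>\<^sub>F t in at_top. 1 \<le> real k * u t) \<or> (\<forall>\<^sub>F t in at_top. u t < 0)"
  proof (cases "\<exists>s\<ge>a. u s > 0")
    case True
    then obtain s where s: "s \<ge> a" "u s > 0" by (elim exE conjE)
    obtain k where k: "1 / u s < real k"
      using reals_Archimedean2 by blast
    have "1 \<le> real k * u t" if "t > s" for t
    proof -
      have "1 \<le> real k * u s"
        using less_imp_le[OF k] s(2) by (simp only: pos_divide_le_eq)
      also have "\<dots> \<le> real k * u t"
        using mono[of s t] s that by (intro mult_left_mono) auto
      finally show ?thesis .
    qed
    then show ?thesis by (auto simp: eventually_at_top_dense)
  next
    case False
    have "u t < 0" if "t > a" for t
    proof -
      have "u t < u (t + 1)" "u (t + 1) \<le> 0"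
        using mono[of t "t + 1"] False that by (auto simp: not_less)
      then show ?thesis by simp
    qed
    then show ?thesis by (auto simp: eventually_at_top_dense)
  qed
qed

text \<open>The bounds give \<open>v' \<le> - 1 / b \<le> - sqrt v\<close>, so \<open>sqrt v\<close>
  has derivative at most -1/2 and cannot stay positive.\<close>

lemma germ_sqrt_decay_False:
  "in_C_inf v \<Longrightarrow> germ_less 0 v \<Longrightarrow> germ_less 0 b \<Longrightarrow> germ_le (b * b * v) 1 \<Longrightarrow>
    germ_le (b * germ_deriv v) (- 1) \<Longrightarrow> False"
proof transfer
  fix v b :: "real \<Rightarrow> real"
  assume *: "\<forall>n. \<exists>a. cont_diff_on n v {a<..}" "\<forall>\<^sub>F t in at_top. 0 < v t" "\<forall>\<^sub>F t in at_top. 0 < b t"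
    "\<forall>\<^sub>F t in at_top. b t * b t * v t \<le> 1" "\<forall>\<^sub>F t in at_top. b t * deriv v t \<le> - 1"
  have "\<forall>\<^sub>F t in at_top. 0 < sqrt (v t)"
    using *(2) by eventually_elim simp
  moreover have "\<forall>\<^sub>F t in at_top. ((\<lambda>t. sqrt (v t)) has_real_derivative deriv v t / (2 * sqrt (v t))) (at t)"
    using C_inf_DERIV[OF *(1)] *(2)
    by eventually_elim (auto intro!: derivative_eq_intros simp: field_simps)
  moreover have "\<forall>\<^sub>F t in at_top. deriv v t / (2 * sqrt (v t)) \<le> - (1/2)"
    using *(2-5)
  proof eventually_elim
    case (elim t)
    have "(b t * sqrt (v t))\<^sup>2 \<le> 1"
      using elim by (simp only: power_mult_distrib real_sqrt_pow2 less_imp_le) (simp add: power2_eq_square)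
    then have "b t * sqrt (v t) \<le> 1"
      by (simp add: abs_square_le_1)
    then have "b t * (deriv v t + sqrt (v t)) \<le> 0"
      using elim by (simp add: algebra_simps)
    then have "deriv v t + sqrt (v t) \<le> 0"
      using elim by (simp add: mult_le_0_iff)
    then show ?case
      using elim by (simp add: field_simps)
  qed
  ultimately show False
    by (rule positive_DERIV_le_neg_False) simp
qed

context includes lifting_syntax
begin

text \<open>Powers of germs arise from the ring structure, not by lifting; this rule makes
  \<open>transfer\<close> read them pointwise.\<close>

lemma germ_power_transfer [transfer_rule]:
  "(pcr_germ ===> (=) ===> pcr_germ) (\<lambda>f n t. f t ^ n) (^)"
proof (intro rel_funI, hypsubst)
  fix f g and n :: nat
  assume *: "pcr_germ f g"
  show "pcr_germ (\<lambda>t. f t ^ n) (g ^ n)"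
  proof (induction n)
    case 0
    then show ?case using one_germ.transfer by simp
  next
    case (Suc n)
    then show ?case using * times_germ.transfer unfolding rel_fun_def by simp
  qed
qed

end

text \<open>With \<open>r = 1 / (m + 1)\<close> the bound reads \<open>g powr r \<le> z\<close>, so
  g' is at least \<open>g powr (1 + r)\<close>, which forces blow-up in finite time. Concretely, the
  positive function \<open>g powr - r\<close> has derivative at most - r.\<close>

lemma germ_log_deriv_power_False:
  "in_C_inf g \<Longrightarrow> germ_less 0 g \<Longrightarrow> germ_deriv g = g * z \<Longrightarrow> germ_less 0 z \<Longrightarrow>
    germ_le g (z ^ Suc m) \<Longrightarrow> False"
proof (transfer fixing: m)
  fix g z :: "real \<Rightarrow> real"
  assume *: "\<forall>n. \<exists>a. cont_diff_on n g {a<..}" "\<forall>\<^sub>F t in at_top. 0 < g t"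
    "\<forall>\<^sub>F t in at_top. deriv g t = g t * z t" "\<forall>\<^sub>F t in at_top. 0 < z t"
    "\<forall>\<^sub>F t in at_top. g t \<le> z t ^ Suc m"
  define r where "r = 1 / real (Suc m)"
  have r: "r > 0" by (simp add: r_def)
  have "\<forall>\<^sub>F t in at_top. 0 < g t powr - r"
    using *(2) by eventually_elim simp
  moreover have "\<forall>\<^sub>F t in at_top. ((\<lambda>t. g t powr - r) has_real_derivative - r * (g t powr - r * z t)) (at t)"
    using C_inf_DERIV[OF *(1)] *(2,3)
  proof eventually_elim
    case (elim t)
    have "((\<lambda>t. g t powr - r) has_real_derivative - r * g t powr (- r - 1) * deriv g t) (at t)"
      using DERIV_fun_powr[OF elim(1,2), of "- r"] by simp
    moreover have "- r * g t powr (- r - 1) * deriv g t = - r * (g t powr - r * z t)"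
      using elim by (simp add: powr_diff)
    ultimately show ?case by (simp only:)
  qed
  moreover have "\<forall>\<^sub>F t in at_top. - r * (g t powr - r * z t) \<le> - r"
    using *(2,4,5)
  proof eventually_elim
    case (elim t)
    have "g t powr r \<le> (z t ^ Suc m) powr r"
      using elim r by (intro powr_mono2) auto
    also have "\<dots> = (z t powr real (Suc m)) powr r"
      using elim by (simp only: powr_realpow)
    also have "\<dots> = z t"
      using elim by (simp add: powr_powr r_def)
    finally have "1 \<le> g t powr - r * z t"
      using elim by (simp add: powr_minus field_simps)
    then have "r * 1 \<le> r * (g t powr - r * z t)"
      using r by (intro mult_left_mono) auto
    then show ?case by simp
  qed
  ultimately show False
    using r by (rule positive_DERIV_le_neg_False)
qed

lemma germ_bounded_deriv_False:
  "in_C_inf w \<Longrightarrow> germ_le w 1 \<Longrightarrow> germ_less 1 (germ_deriv w) \<Longrightarrow> False"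
proof transfer
  fix w :: "real \<Rightarrow> real"
  assume *: "\<forall>n. \<exists>a. cont_diff_on n w {a<..}" "\<forall>\<^sub>F t in at_top. w t \<le> 1"
    "\<forall>\<^sub>F t in at_top. 1 < deriv w t"
  \<comment> \<open>The constant 2 in place of 1 gives strict positivity, as w may equal 1.\<close>
  have "\<forall>\<^sub>F t in at_top. 0 < 2 - w t"
    using *(2) by eventually_elim simp
  moreover have "\<forall>\<^sub>F t in at_top. ((\<lambda>t. 2 - w t) has_real_derivative - deriv w t) (at t)"
    using C_inf_DERIV[OF *(1)] by eventually_elim (auto intro!: derivative_eq_intros)
  moreover have "\<forall>\<^sub>F t in at_top. - deriv w t \<le> - 1"
    using *(3) by eventually_elim simp
  ultimately show False
    by (rule positive_DERIV_le_neg_False) simp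
qed

lemma iexp_mono: "x \<le> y \<Longrightarrow> (exp ^^ n) x \<le> (exp ^^ n) (y :: real)"
  by (induction n) auto

lemma funpow_pointwise_exp: "((\<lambda>f t. exp (f t)) ^^ n) h = (\<lambda>t. (exp ^^ n) (h t))"
  by (induction n) simp_all

text \<open>Put \<open>e = exp_(n+1)(h)\<close>. Integrating \<open>(ln g)' = z \<le> e\<close>
  bounds \<open>ln g t\<close> by about \<open>t * e t\<close>, whereas \<open>ln g\<close> exceeds
  both \<open>exp e\<close> and \<open>exp t\<close>. The first absorbs the factor e up to a term of
  order \<open>t^2\<close>, and the second rules that term out.\<close>

lemma germ_log_deriv_iexp_False:
  "in_C_inf g \<Longrightarrow> in_C_inf h \<Longrightarrow> germ_le 0 (germ_deriv h) \<or> germ_le (germ_deriv h) 0 \<Longrightarrow>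
    germ_deriv g = g * z \<Longrightarrow> germ_le z ((germ_exp ^^ Suc n) h) \<Longrightarrow>
    germ_less ((germ_exp ^^ Suc (Suc (Suc n))) h) g \<Longrightarrow> germ_less ((germ_exp ^^ 2) germ_x) g \<Longrightarrow> False"
proof (transfer fixing: n)
  fix g h z :: "real \<Rightarrow> real"
  define e where "e = (\<lambda>t. (exp ^^ Suc n) (h t))"
  assume *: "\<forall>n. \<exists>a. cont_diff_on n g {a<..}" "\<forall>n. \<exists>a. cont_diff_on n h {a<..}"
    "(\<forall>\<^sub>F t in at_top. 0 \<le> deriv h t) \<or> (\<forall>\<^sub>F t in at_top. deriv h t \<le> 0)"
    "\<forall>\<^sub>F t in at_top. deriv g t = g t * z t"
    "\<forall>\<^sub>F t in at_top. z t \<le> ((\<lambda>f t. exp (f t)) ^^ Suc n) h t"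
    "\<forall>\<^sub>F t in at_top. ((\<lambda>f t. exp (f t)) ^^ Suc (Suc (Suc n))) h t < g t"
    "\<forall>\<^sub>F t in at_top. ((\<lambda>f t. exp (f t)) ^^ 2) (\<lambda>t. t) t < g t"
  have epos: "e t > 0" for t
    by (simp add: e_def)
  have "\<forall>\<^sub>F t in at_top. z t \<le> e t" "\<forall>\<^sub>F t in at_top. exp (exp (e t)) < g t"
    "\<forall>\<^sub>F t in at_top. exp (exp t) < g t"
    using *(5-7) unfolding funpow_pointwise_exp by (simp_all add: e_def numeral_2_eq_2)
  moreover have "\<forall>\<^sub>F t in at_top. (g has_real_derivative g t * z t) (at t)"
    using C_inf_DERIV[OF *(1)] *(4) by eventually_elim simp
  moreover note C_inf_DERIV[OF *(2)]
  ultimately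
  have "\<forall>\<^sub>F t in at_top. z t \<le> e t \<and> exp (exp (e t)) < g t \<and> exp (exp t) < g t \<and>
     (g has_real_derivative g t * z t) (at t) \<and>
     (h has_real_derivative deriv h t) (at t)"
    by (simp add: eventually_conj_iff)
  with *(3) obtain b c where "\<And>t. t \<ge> b \<Longrightarrow> z t \<le> e t \<and> exp (exp (e t)) < g t \<and> exp (exp t) < g t \<and>
     (g has_real_derivative g t * z t) (at t) \<and>
     (h has_real_derivative deriv h t) (at t)"
    "(\<forall>t\<ge>c. 0 \<le> deriv h t) \<or> (\<forall>t\<ge>c. deriv h t \<le> 0)"
    unfolding eventually_at_top_linorder by (elim exE disjE) auto
  moreover define a where "a = max 0 (max b c)"
  ultimately have a: "\<And>t. t \<ge> a \<Longrightarrow> z t \<le> e t" "\<And>t. t \<ge> a \<Longrightarrow> exp (exp (e t)) < g t"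
    "\<And>t. t \<ge> a \<Longrightarrow> exp (exp t) < g t" "\<And>t. t \<ge> a \<Longrightarrow> (g has_real_derivative g t * z t) (at t)"
    "\<And>t. t \<ge> a \<Longrightarrow> (h has_real_derivative deriv h t) (at t)" "a \<ge> 0"
    and sgn: "(\<forall>t\<ge>a. 0 \<le> deriv h t) \<or> (\<forall>t\<ge>a. deriv h t \<le> 0)"
    by auto
  have gpos: "g t > 0" if "t \<ge> a" for t
    using a(3)[OF that] by (rule less_trans[rotated]) simp
  \<comment> \<open>h is eventually monotone, so e on the interval from a to t is at most its value
    at one of the endpoints; the sum covers both directions.\<close>
  have esum: "e s \<le> e a + e t" if "a \<le> s" "s \<le> t" for s t
    using sgn
  proof
    assume "\<forall>t\<ge>a. 0 \<le> deriv h t"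
    then have "h s \<le> h t"
      using a(5) that by (intro DERIV_nonneg_imp_nondecreasing[OF that(2)]) (meson order_trans)
    then have "e s \<le> e t"
      unfolding e_def by (rule iexp_mono)
    then show ?thesis using epos[of a] by simp
  next
    assume "\<forall>t\<ge>a. deriv h t \<le> 0"
    then have "h s \<le> h a"
      using a(5) that by (intro DERIV_nonpos_imp_nonincreasing[OF that(1)]) (meson order_trans)
    then have "e s \<le> e a"
      unfolding e_def by (rule iexp_mono)
    then show ?thesis using epos[of t] by simp
  qed
  have bound: "exp t \<le> 2 * ln (g a) + 2 * e a * t + 4 * t\<^sup>2" if t: "t > a" for t
  proof -
    have "((\<lambda>t. ln (g t)) has_real_derivative z s) (at s)" if "s \<ge> a" for s
      using a(4)[OF that] gpos[OF that] by (auto intro!: derivative_eq_intros)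
    then obtain s where s: "a < s" "s < t" "ln (g t) - ln (g a) = (t - a) * z s"
      using MVT2[OF t, of "\<lambda>t. ln (g t)" z] by auto
    have "(t - a) * z s \<le> (t - a) * (e a + e t)"
      using a(1)[of s] esum[of s t] s t by (intro mult_left_mono) auto
    also have "\<dots> \<le> t * (e a + e t)"
      using \<open>a \<ge> 0\<close> epos[of a] epos[of t] by (intro mult_right_mono) auto
    finally have 1: "ln (g t) \<le> ln (g a) + t * e a + t * e t"
      using s by (simp add: algebra_simps)
    have 2: "exp t \<le> ln (g t)" "exp (e t) \<le> ln (g t)"
      using a(2,3)[of t] gpos[of t] t by (auto simp: ln_ge_iff)
    have "(e t / 2)\<^sup>2 \<le> (exp (e t / 2))\<^sup>2"
    proof (rule power_mono)
      show "e t / 2 \<le> exp (e t / 2)"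
        using exp_ge_add_one_self[of "e t / 2"] by linarith
    qed (use epos[of t] in simp)
    also have "\<dots> = exp (e t)"
      by (simp flip: exp_double)
    finally have 3: "(e t)\<^sup>2 / 4 \<le> exp (e t)"
      by (simp add: power_divide)
    \<comment> \<open>The weights are chosen so that \<open>t * e t\<close> costs at most half of
      \<open>ln (g t)\<close>, through \<open>e\<^sup>2 / 4 \<le> exp e\<close>, plus
      \<open>2 * t\<^sup>2\<close>.\<close>
    have "0 \<le> (e t / 2 - 2 * t)\<^sup>2"
      by simp
    then have 4: "2 * (t * e t) \<le> (e t)\<^sup>2 / 4 + 4 * t\<^sup>2"
      by (simp add: power2_eq_square algebra_simps)
    show ?thesis
      using 1 2 3 4 by (simp add: algebra_simps)
  qed
  have "\<forall>\<^sub>F t in at_top. 2 * ln (g a) + 2 * e a * t + 4 * t\<^sup>2 < exp t"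
    by real_asymp
  then have "\<forall>\<^sub>F t in at_top. 2 * ln (g a) + 2 * e a * t + 4 * t\<^sup>2 < exp t \<and> t > a"
    using eventually_gt_at_top[of a] by eventually_elim simp
  then obtain t where "2 * ln (g a) + 2 * e a * t + 4 * t\<^sup>2 < exp t" "t > a"
    using eventually_happens'[OF trivial_limit_at_top_linorder] by blast
  with bound[of t] show False by simp
qed

section \<open>Cofinality of a Hardy field in its extension by the identity germ\<close>

lemma C_inf_subfield_diff: "C_inf_subfield K \<Longrightarrow> f \<in> K \<Longrightarrow> g \<in> K \<Longrightarrow> f - g \<in> K"
  unfolding C_inf_subfield_def by (metis add_uminus_conv_diff)

lemma C_inf_subfield_of_nat: "C_inf_subfield K \<Longrightarrow> of_nat n \<in> K"
  by (induction n) (simp_all add: C_inf_subfield_def)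

lemma C_inf_subfield_power: "C_inf_subfield K \<Longrightarrow> f \<in> K \<Longrightarrow> f ^ n \<in> K"
  by (induction n) (simp_all add: C_inf_subfield_def)

lemma C_inf_subfield_sum: "C_inf_subfield K \<Longrightarrow> (\<And>i. i \<in> A \<Longrightarrow> f i \<in> K) \<Longrightarrow> sum f A \<in> K"
  by (induction A rule: infinite_finite_induct) (simp_all add: C_inf_subfield_def)

lemma C_inf_subfield_linear:
  assumes "C_inf_subfield K" "f \<in> K" "g \<in> K"
  shows "germ_less f g \<or> germ_le g f"
proof (cases "g - f = 0")
  case True
  then have "germ_le g f" by simp (transfer, simp)
  then show ?thesis ..
next
  case False
  then have "germ_less 0 (g - f) \<or> germ_less (g - f) 0"
    using assms by (intro C_inf_subfield_trichotomy C_inf_subfield_diff)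
  moreover have "germ_less f g" if "germ_less 0 (g - f)"
    using that germ_less_diff by blast
  moreover have "germ_le g f" if "germ_less (g - f) 0"
    using that by transfer (auto elim: eventually_mono)
  ultimately show ?thesis by blast
qed

lemma germ_less_imp_le: "germ_less f g \<Longrightarrow> germ_le f g"
  by transfer (auto elim: eventually_mono)

lemma germ_le_refl: "germ_le f f"
  by transfer simp

lemma germ_le_trans: "germ_le f g \<Longrightarrow> germ_le g h \<Longrightarrow> germ_le f h"
  by (transfer, erule (1) eventually_elim2, simp)

text \<open>Germs given by polynomials in x over K of degree below n. The leading coefficient may
  vanish, so n is only a bound, and splitting off the top term is the induction step in the lower
  bound below.\<close>

fun x_polys :: "germ set \<Rightarrow> nat \<Rightarrow> germ set" where
  "x_polys K 0 = {0}"
| "x_polys K (Suc n) = {a * germ_x ^ n + u |a u. a \<in> K \<and> u \<in> x_polys K n}"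

declare x_polys.simps(2) [simp del]

lemma x_polys_SucI: "a \<in> K \<Longrightarrow> u \<in> x_polys K n \<Longrightarrow> a * germ_x ^ n + u \<in> x_polys K (Suc n)"
  by (auto simp: x_polys.simps(2))

lemma x_polys_SucE:
  assumes "u \<in> x_polys K (Suc n)"
  obtains a v where "u = a * germ_x ^ n + v" "a \<in> K" "v \<in> x_polys K n"
  using assms by (auto simp: x_polys.simps(2))

text \<open>The denominator q is required to be bounded away from 0 by some 1/b with b in K. This
  makes it a unit in the ring of germs and controls the size of the fraction.\<close>

definition x_fractions :: "germ set \<Rightarrow> germ set" where
  "x_fractions K = {f. in_C_inf f \<and> (\<exists>m n p q b. p \<in> x_polys K m \<and> q \<in> x_polys K n \<and>
     b \<in> K \<and> germ_le 1 (b * q) \<and> f * q = p)}"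

lemma x_fractionsI:
  "in_C_inf f \<Longrightarrow> p \<in> x_polys K m \<Longrightarrow> q \<in> x_polys K n \<Longrightarrow> b \<in> K \<Longrightarrow> germ_le 1 (b * q) \<Longrightarrow> f * q = p \<Longrightarrow>
    f \<in> x_fractions K"
  unfolding x_fractions_def by blast

lemma germ_le_1_mult_sign: "germ_le 1 (b * u) \<Longrightarrow> germ_less 0 b \<Longrightarrow> germ_less 0 u"
proof transfer
  fix b u :: "real \<Rightarrow> real"
  assume "\<forall>\<^sub>F t in at_top. 1 \<le> b t * u t" "\<forall>\<^sub>F t in at_top. 0 < b t"
  then show "\<forall>\<^sub>F t in at_top. 0 < u t"
  proof eventually_elim
    case (elim t)
    then have "0 < b t * u t" by linarith
    with elim(2) show ?case by (simp add: zero_less_mult_iff)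
  qed
qed

lemma germ_less_uminus: "germ_less 0 (- b) \<longleftrightarrow> germ_less b 0" "germ_less (- b) 0 \<longleftrightarrow> germ_less 0 b"
  by (transfer; simp)+

lemma not_germ_le_1_0: "\<not> germ_le 1 0"
  by transfer simp

section \<open>Arithmetic and derivation of polynomials in x over a Hardy field\<close>

context
  fixes K :: "germ set"
  assumes K: "hardy_field K"
begin

lemma hardy_field_subfield: "C_inf_subfield K"
  using K by (simp add: hardy_field_def)

lemma hardy_field_closed:
  "f \<in> K \<Longrightarrow> in_C_inf f" "0 \<in> K" "1 \<in> K" "f \<in> K \<Longrightarrow> g \<in> K \<Longrightarrow> f + g \<in> K"
  "f \<in> K \<Longrightarrow> - f \<in> K" "f \<in> K \<Longrightarrow> g \<in> K \<Longrightarrow> f * g \<in> K" "f \<in> K \<Longrightarrow> germ_deriv f \<in> K"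
  using K by (simp_all add: hardy_field_def C_inf_subfield_def)

lemma hardy_field_inverse: "f \<in> K \<Longrightarrow> f \<noteq> 0 \<Longrightarrow> \<exists>g\<in>K. f * g = 1"
  using K by (simp add: hardy_field_def C_inf_subfield_def)

lemma x_polys_0: "0 \<in> x_polys K n"
  using x_polys_SucI[OF hardy_field_closed(2)] by (induction n) force+

lemma x_polys_Suc: "u \<in> x_polys K n \<Longrightarrow> u \<in> x_polys K (Suc n)"
  using x_polys_SucI[OF hardy_field_closed(2)] by force

lemma x_polys_mono: "u \<in> x_polys K m \<Longrightarrow> m \<le> n \<Longrightarrow> u \<in> x_polys K n"
  by (induction n) (auto simp: le_Suc_eq intro: x_polys_Suc)

lemma x_polys_add: "u \<in> x_polys K n \<Longrightarrow> v \<in> x_polys K n \<Longrightarrow> u + v \<in> x_polys K n"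
proof (induction n arbitrary: u v)
  case (Suc n)
  obtain a u' where u: "u = a * germ_x ^ n + u'" "a \<in> K" "u' \<in> x_polys K n"
    using Suc.prems(1) by (rule x_polys_SucE)
  obtain b v' where v: "v = b * germ_x ^ n + v'" "b \<in> K" "v' \<in> x_polys K n"
    using Suc.prems(2) by (rule x_polys_SucE)
  have "u + v = (a + b) * germ_x ^ n + (u' + v')"
    by (simp add: u(1) v(1) algebra_simps)
  then show ?case
    using x_polys_SucI[OF hardy_field_closed(4)[OF u(2) v(2)] Suc.IH[OF u(3) v(3)]] by simp
qed simp

lemma x_polys_scale: "c \<in> K \<Longrightarrow> u \<in> x_polys K n \<Longrightarrow> c * u \<in> x_polys K n"
proof (induction n arbitrary: u)
  case (Suc n)
  obtain a u' where u: "u = a * germ_x ^ n + u'" "a \<in> K" "u' \<in> x_polys K n"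
    using Suc.prems(2) by (rule x_polys_SucE)
  have "c * u = (c * a) * germ_x ^ n + c * u'"
    by (simp add: u(1) algebra_simps)
  then show ?case
    using x_polys_SucI[OF hardy_field_closed(6)[OF Suc.prems(1) u(2)] Suc.IH[OF Suc.prems(1) u(3)]] by simp
qed simp

lemma x_polys_uminus: "u \<in> x_polys K n \<Longrightarrow> - u \<in> x_polys K n"
  using x_polys_scale[of "- 1" u n] hardy_field_closed by simp

lemma x_polys_x_mult: "u \<in> x_polys K n \<Longrightarrow> germ_x * u \<in> x_polys K (Suc n)"
proof (induction n arbitrary: u)
  case (Suc n)
  then obtain a u' where u: "u = a * germ_x ^ n + u'" "a \<in> K" "u' \<in> x_polys K n"
    by (auto elim: x_polys_SucE)
  have "germ_x * u = a * germ_x ^ Suc n + germ_x * u'"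
    by (simp add: u(1) algebra_simps)
  then show ?case
    using x_polys_SucI[OF u(2) Suc.IH[OF u(3)]] by simp
qed (simp add: x_polys_0)

lemma x_polys_xpow_mult: "u \<in> x_polys K n \<Longrightarrow> germ_x ^ m * u \<in> x_polys K (m + n)"
  by (induction m) (auto simp: mult.assoc intro: x_polys_x_mult)

lemma x_polys_mult: "u \<in> x_polys K m \<Longrightarrow> v \<in> x_polys K n \<Longrightarrow> u * v \<in> x_polys K (m + n)"
proof (induction m arbitrary: u)
  case 0
  then show ?case by (simp add: x_polys_0)
next
  case (Suc m)
  then obtain a u' where u: "u = a * germ_x ^ m + u'" "a \<in> K" "u' \<in> x_polys K m"
    by (auto elim: x_polys_SucE)
  have "u * v = germ_x ^ m * (a * v) + u' * v"
    by (simp add: u(1) algebra_simps)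
  then have "u * v \<in> x_polys K (m + n)"
    using Suc.IH[OF u(3) Suc.prems(2)] x_polys_xpow_mult[OF x_polys_scale[OF u(2) Suc.prems(2)], of m]
    by (simp add: x_polys_add)
  then show ?case
    using x_polys_Suc by simp
qed

lemma const_in_x_polys: "a \<in> K \<Longrightarrow> a \<in> x_polys K (Suc 0)"
  using x_polys_SucI[of a K 0 0] by simp

lemma xpow_in_x_polys: "germ_x ^ n \<in> x_polys K (Suc n)"
  using x_polys_xpow_mult[OF const_in_x_polys[OF hardy_field_closed(3)], of n] by simp

lemma in_C_inf_xpow: "in_C_inf (germ_x ^ n)"
  using in_C_inf_const[of 1] of_nat_germ[of 1]
  by (induction n) (auto intro: in_C_inf_mult in_C_inf_x)

lemma in_C_inf_x_polys: "u \<in> x_polys K n \<Longrightarrow> in_C_inf u"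
  by (induction n arbitrary: u)
    (auto elim!: x_polys_SucE intro!: in_C_inf_add in_C_inf_mult in_C_inf_xpow intro: hardy_field_closed(1) simp: hardy_field_closed(2))

lemma germ_deriv_xpow: "germ_deriv (germ_x ^ n) \<in> x_polys K n"
proof (induction n)
  case 0
  then show ?case using of_nat_germ[of 1] germ_deriv_const[of 1] by simp
next
  case (Suc n)
  have "germ_deriv (germ_x ^ Suc n) = germ_x ^ n + germ_x * germ_deriv (germ_x ^ n)"
    by (simp add: germ_deriv_mult in_C_inf_x in_C_inf_xpow germ_deriv_x)
  then show ?case
    using x_polys_add[OF xpow_in_x_polys[of n] x_polys_x_mult[OF Suc]] by simp
qed

lemma germ_deriv_x_polys: "u \<in> x_polys K n \<Longrightarrow> germ_deriv u \<in> x_polys K n"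
proof (induction n arbitrary: u)
  case 0
  then show ?case using of_nat_germ[of 0] germ_deriv_const[of 0] by simp
next
  case (Suc n)
  then obtain a u' where u: "u = a * germ_x ^ n + u'" "a \<in> K" "u' \<in> x_polys K n"
    by (auto elim: x_polys_SucE)
  have "germ_deriv u = germ_deriv a * germ_x ^ n + (a * germ_deriv (germ_x ^ n) + germ_deriv u')"
    using u by (simp add: germ_deriv_add germ_deriv_mult in_C_inf_mult in_C_inf_xpow in_C_inf_x_polys hardy_field_closed
        algebra_simps)
  moreover have "a * germ_deriv (germ_x ^ n) + germ_deriv u' \<in> x_polys K n"
    using Suc.IH u by (auto intro!: x_polys_add x_polys_scale germ_deriv_xpow)
  ultimately show ?case
    using x_polys_SucI[OF hardy_field_closed(7)[OF u(2)]] by simp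
qed

text \<open>The sign of b is known because b lies in a Hardy field, and u inherits it. In this way a
  lower bound over K yields an eventual sign for a germ outside K.\<close>

lemma germ_le_1_mult_cases:
  assumes "b \<in> K" "germ_le 1 (b * u)"
  shows "germ_less 0 b \<and> germ_less 0 u \<or> germ_less b 0 \<and> germ_less u 0"
proof -
  have "b \<noteq> 0"
    using assms(2) not_germ_le_1_0 by auto
  then have "germ_less 0 b \<or> germ_less b 0"
    using C_inf_subfield_trichotomy[OF hardy_field_subfield assms(1)] by blast
  then show ?thesis
    using germ_le_1_mult_sign[of b u] germ_le_1_mult_sign[of "- b" "- u"] assms(2)
    by (auto simp: germ_less_uminus)
qed

text \<open>K need not contain all real constants, but it contains the integers, and the reals are
  Archimedean.\<close>

lemma germ_const_cases: "germ_const c = 0 \<or> (\<exists>b\<in>K. germ_le 1 (b * germ_const c))"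
proof (cases "c = 0")
  case True
  then show ?thesis using of_nat_germ[of 0] by simp
next
  case False
  obtain k where "1 / \<bar>c\<bar> < real k"
    using reals_Archimedean2 by blast
  then have k: "1 \<le> real k * \<bar>c\<bar>"
    using False by (simp add: field_simps)
  show ?thesis
  proof (cases "c > 0")
    case True
    have "germ_le 1 (of_nat k * germ_const c)"
      unfolding of_nat_germ using k True by (transfer fixing: k c) simp
    then show ?thesis using C_inf_subfield_of_nat[OF hardy_field_subfield] by blast
  next
    case False
    have "germ_le 1 (- of_nat k * germ_const c)"
      unfolding of_nat_germ using k False by (transfer fixing: k c) simp
    then show ?thesis using C_inf_subfield_of_nat[OF hardy_field_subfield] hardy_field_closed(5) by blast
  qed
qed

text \<open>A vanishing derivative leaves a constant; otherwise the derivative has an eventual sign,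
  m is eventually strictly monotone, and so it has an eventual sign as well.\<close>

lemma antiderivative_sign:
  assumes m: "in_C_inf m" and "germ_deriv m = 0 \<or> (\<exists>b\<in>K. germ_le 1 (b * germ_deriv m))"
  shows "m = 0 \<or> germ_less 0 m \<or> germ_less m 0"
  using assms(2)
proof (elim disjE bexE)
  assume "germ_deriv m = 0"
  then show ?thesis
    using germ_deriv_0_imp_const[OF m] germ_const_cases germ_le_1_mult_cases by blast
next
  have pos: "u = 0 \<or> germ_less 0 u \<or> germ_less u 0" if u: "in_C_inf u" "germ_less 0 (germ_deriv u)" for u
    using germ_deriv_pos_sign[OF u] germ_le_1_mult_cases C_inf_subfield_of_nat[OF hardy_field_subfield]
    by (metis of_nat_germ)
  fix b assume "b \<in> K" "germ_le 1 (b * germ_deriv m)"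
  then have "germ_less 0 (germ_deriv m) \<or> germ_less (germ_deriv m) 0"
    using germ_le_1_mult_cases by blast
  then show ?thesis
    using pos[of m] pos[of "- m"] m by (auto simp: germ_less_uminus in_C_inf_uminus germ_deriv_uminus)
qed

text \<open>
  If \<open>v = - m > 0\<close> were at most \<open>b\<^sup>-\<^sup>2\<close>, then \<open>v' \<le> - b\<^sup>-\<^sup>1 \<le> - sqrt v\<close>, so that \<open>sqrt v\<close>
  would have derivative at most \<open>-1/2\<close>.
\<close>

lemma antiderivative_lower_bound_pos:
  assumes m: "in_C_inf m" and b: "b \<in> K" "germ_le 1 (b * germ_deriv m)" "germ_less 0 b"
    and sgn: "\<And>k. k \<in> K \<Longrightarrow> m + k = 0 \<or> germ_less 0 (m + k) \<or> germ_less (m + k) 0"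
  shows "\<exists>b\<in>K. germ_le 1 (b * m)"
proof -
  have "germ_less 0 (germ_deriv m)"
    using b by (blast intro: germ_le_1_mult_sign)
  from germ_deriv_pos_sign[OF m this] show ?thesis
  proof
    assume "\<exists>k. germ_le 1 (germ_const (real k) * m)"
    then show ?thesis
      using C_inf_subfield_of_nat[OF hardy_field_subfield] by (metis of_nat_germ)
  next
    assume neg: "germ_less m 0"
    have "b * b \<noteq> 0"
      using b(3)
    proof transfer
      fix b :: "real \<Rightarrow> real"
      assume pos: "\<forall>\<^sub>F t in at_top. 0 < b t"
      show "\<not> (\<forall>\<^sub>F t in at_top. b t * b t = 0)"
      proof
        assume "\<forall>\<^sub>F t in at_top. b t * b t = 0"
        with pos have "\<forall>\<^sub>F t :: real in at_top. False"
          by eventually_elim simp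
        then show False by simp
      qed
    qed
    then obtain c where c: "c \<in> K" "b * b * c = 1"
      using hardy_field_inverse[OF hardy_field_closed(6)[OF b(1) b(1)]] by blast
    have "germ_less (m + c) 0"
    proof (rule ccontr)
      assume "\<not> germ_less (m + c) 0"
      then have "m + c = 0 \<or> germ_less 0 (m + c)"
        using sgn[OF c(1)] by metis
      then have "germ_le 0 (m + c)"
        using germ_less_imp_le germ_le_refl by metis
      with b(3) c(2) have "germ_le (b * b * - m) 1"
      proof transfer
        fix b m c :: "real \<Rightarrow> real"
        assume "\<forall>\<^sub>F t in at_top. 0 < b t" "\<forall>\<^sub>F t in at_top. b t * b t * c t = 1"
          "\<forall>\<^sub>F t in at_top. 0 \<le> m t + c t"
        then show "\<forall>\<^sub>F t in at_top. b t * b t * - m t \<le> 1"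
        proof eventually_elim
          case (elim t)
          have "0 \<le> b t * b t * (m t + c t)"
            using elim by simp
          then show ?case using elim by (simp add: algebra_simps)
        qed
      qed
      moreover have "germ_le (b * germ_deriv (- m)) (- 1)"
        using b(2) unfolding germ_deriv_uminus[OF m] by transfer simp
      ultimately show False
        using germ_sqrt_decay_False[of "- m" b] neg b(3) m by (simp add: germ_less_uminus in_C_inf_uminus)
    qed
    with b(3) c(2) have "germ_le 1 (- (b * b) * m)"
    proof transfer
      fix b m c :: "real \<Rightarrow> real"
      assume "\<forall>\<^sub>F t in at_top. 0 < b t" "\<forall>\<^sub>F t in at_top. b t * b t * c t = 1"
        "\<forall>\<^sub>F t in at_top. m t + c t < 0"
      then show "\<forall>\<^sub>F t in at_top. 1 \<le> - (b t * b t) * m t"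
      proof eventually_elim
        case (elim t)
        have "b t * b t * (m t + c t) \<le> 0"
          using elim by (simp add: mult_nonneg_nonpos)
        then show ?case using elim by (simp add: algebra_simps)
      qed
    qed
    then show ?thesis
      using hardy_field_closed(5)[OF hardy_field_closed(6)[OF b(1) b(1)]] by blast
  qed
qed

lemma antiderivative_lower_bound:
  assumes m: "in_C_inf m" and b: "b \<in> K" "germ_le 1 (b * germ_deriv m)"
    and sgn: "\<And>k. k \<in> K \<Longrightarrow> m + k = 0 \<or> germ_less 0 (m + k) \<or> germ_less (m + k) 0"
  shows "\<exists>b\<in>K. germ_le 1 (b * m)"
  using germ_le_1_mult_cases[OF b]
proof (elim disjE conjE)
  assume "germ_less 0 b"
  then show ?thesis using assms antiderivative_lower_bound_pos by blast
next
  assume "germ_less b 0"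
  have "- m + k = 0 \<or> germ_less 0 (- m + k) \<or> germ_less (- m + k) 0" if "k \<in> K" for k
    using sgn[OF hardy_field_closed(5)[OF that]] germ_less_uminus[of "m - k"] by (auto simp: algebra_simps)
  then have "\<exists>b\<in>K. germ_le 1 (b * - m)"
    using antiderivative_lower_bound_pos[of "- m" "- b"] m b \<open>germ_less b 0\<close>
    by (auto simp: in_C_inf_uminus germ_deriv_uminus germ_less_uminus hardy_field_closed)
  then show ?thesis
    using hardy_field_closed(5) by (metis minus_mult_commute)
qed

text \<open>After division by the leading coefficient the polynomial is monic and its derivative has
  lower degree, so the induction hypothesis bounds the derivative below. The same applies to every
  shift by an element of K, which supplies the signs needed to pass from the derivative to the
  polynomial. Consequently nonzero polynomials have eventual signs and are units.\<close>

lemma x_polys_lower_bound: "u \<in> x_polys K n \<Longrightarrow> u = 0 \<or> (\<exists>b\<in>K. germ_le 1 (b * u))"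
proof (induction n arbitrary: u)
  case (Suc n)
  then obtain a v where u: "u = a * germ_x ^ n + v" "a \<in> K" "v \<in> x_polys K n"
    by (auto elim: x_polys_SucE)
  show ?case
  proof (cases "a = 0")
    case True
    then show ?thesis using u Suc.IH by simp
  next
    case False
    then obtain c where c: "c \<in> K" "a * c = 1"
      using hardy_field_inverse u by blast
    define m where "m = germ_x ^ n + c * v"
    have am: "a * m = u" "c * u = m"
      using c(2) by (simp_all add: m_def u(1) distrib_left mult.commute[of c a] flip: mult.assoc)
    \<comment> \<open>Monicity makes differentiation lower the degree. The side condition says that
      the shift k lies below the leading term; for n = 0 there is room only for k = 0.\<close>
    have mk: "germ_deriv (m + k) \<in> x_polys K n" "in_C_inf (m + k)" if "k \<in> K" "n > 0 \<or> k = 0" for k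
    proof -
      have w: "c * v + k \<in> x_polys K n"
        using that u c x_polys_scale x_polys_add x_polys_mono[OF const_in_x_polys[of k], of n]
        by (cases n) auto
      have eq: "m + k = germ_x ^ n + (c * v + k)"
        by (simp add: m_def)
      show "in_C_inf (m + k)"
        unfolding eq using w by (intro in_C_inf_add in_C_inf_xpow in_C_inf_x_polys)
      show "germ_deriv (m + k) \<in> x_polys K n"
        unfolding eq using w
        by (simp add: germ_deriv_add in_C_inf_xpow in_C_inf_x_polys x_polys_add germ_deriv_xpow germ_deriv_x_polys)
    qed
    have "m = 0 \<or> (\<exists>b\<in>K. germ_le 1 (b * m))"
    proof (cases "n = 0")
      case True
      then have "m = 1"
        using u(3) by (simp add: m_def)
      then show ?thesis
        using of_nat_germ[of 1] germ_const_cases[of 1] by simp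
    next
      case False
      then have sgn: "m + k = 0 \<or> germ_less 0 (m + k) \<or> germ_less (m + k) 0" if "k \<in> K" for k
        using antiderivative_sign mk that Suc.IH by blast
      from mk[of 0] have m: "in_C_inf m" "germ_deriv m \<in> x_polys K n"
        by (simp_all add: hardy_field_closed)
      from Suc.IH[OF m(2)] show ?thesis
      proof
        assume "germ_deriv m = 0"
        then show ?thesis
          using germ_deriv_0_imp_const[OF m(1)] germ_const_cases by blast
      next
        assume "\<exists>b\<in>K. germ_le 1 (b * germ_deriv m)"
        then show ?thesis
          using antiderivative_lower_bound[OF m(1)] sgn by blast
      qed
    qed
    then show ?thesis
      using am c(1) hardy_field_closed(6) by (metis mult.assoc mult_zero_right)
  qed
qed simp

section \<open>The field of fractions of polynomials in x and bounds for its elements\<close>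

lemma x_polys_subset_x_fractions:
  assumes "f \<in> x_polys K n"
  shows "f \<in> x_fractions K"
  by (rule x_fractionsI[OF in_C_inf_x_polys[OF assms] assms const_in_x_polys[OF hardy_field_closed(3)] hardy_field_closed(3)])
    (simp_all add: germ_le_refl)

text \<open>Sums and products use the common denominator. The inverse of p/q is q/p, an admissible
  fraction because \<open>x_polys_lower_bound\<close> applies to the nonzero numerator p.\<close>

lemma C_inf_subfield_x_fractions: "C_inf_subfield (x_fractions K)"
proof -
  have unit: "\<exists>r. q * r = 1" if "germ_le 1 (b * q)" for b q
  proof -
    have "q * germ_inverse q = 1"
      using that
    proof transfer
      fix b q :: "real \<Rightarrow> real"
      assume "\<forall>\<^sub>F t in at_top. 1 \<le> b t * q t"
      then show "\<forall>\<^sub>F t in at_top. q t * inverse (q t) = 1"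
        by eventually_elim (auto intro!: right_inverse)
    qed
    then show ?thesis ..
  qed
  have prod: "germ_le 1 (b * c * (p * q))" if "germ_le 1 (b * p)" "germ_le 1 (c * q)" for b c p q
  proof -
    have "germ_le 1 ((b * p) * (c * q))"
      using that
    proof transfer
      fix b c p q :: "real \<Rightarrow> real"
      assume "\<forall>\<^sub>F t in at_top. 1 \<le> b t * p t" "\<forall>\<^sub>F t in at_top. 1 \<le> c t * q t"
      then show "\<forall>\<^sub>F t in at_top. 1 \<le> b t * p t * (c t * q t)"
      proof eventually_elim
        case (elim t)
        then show ?case
          using mult_mono[of 1 "b t * p t" 1 "c t * q t"] by simp
      qed
    qed
    then show ?thesis by (simp add: ac_simps)
  qed
  show ?thesis
    unfolding C_inf_subfield_def
  proof (intro conjI ballI impI)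
    show "0 \<in> x_fractions K" "1 \<in> x_fractions K"
      using x_polys_subset_x_fractions const_in_x_polys hardy_field_closed(2,3) by blast+
  next
    fix f assume f: "f \<in> x_fractions K"
    then show "in_C_inf f"
      by (simp add: x_fractions_def)
    obtain m n p q b where pq: "p \<in> x_polys K m" "q \<in> x_polys K n" "b \<in> K" "germ_le 1 (b * q)" "f * q = p"
      using f by (auto simp: x_fractions_def)
    show "- f \<in> x_fractions K"
      using x_fractionsI[OF in_C_inf_uminus[OF \<open>in_C_inf f\<close>] x_polys_uminus[OF pq(1)] pq(2,3,4)] pq(5)
      by simp
    show "\<exists>g\<in>x_fractions K. f * g = 1" if "f \<noteq> 0"
    proof -
      obtain r where r: "q * r = 1"
        using unit[OF pq(4)] by blast
      have "p \<noteq> 0"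
          using pq(5) r \<open>f \<noteq> 0\<close> by (metis mult.assoc mult.right_neutral mult_zero_left)
      then obtain c where c: "c \<in> K" "germ_le 1 (c * p)"
        using x_polys_lower_bound[OF pq(1)] by blast
      obtain s where s: "p * s = 1"
        using unit[OF c(2)] by blast
      have 1: "f * (q * s) = 1"
        using pq(5) s by (metis mult.assoc)
      have "q * s * p = q * (p * s)"
        by (simp add: ac_simps)
      then have "q * s * p = q"
        using s by simp
      moreover have "in_C_inf (q * s)"
        using in_C_inf_inverse[OF \<open>in_C_inf f\<close> 1] .
      ultimately have "q * s \<in> x_fractions K"
        using x_fractionsI[OF _ pq(2,1) c] by blast
      then show ?thesis
        using 1 by blast
    qed
    fix g assume g: "g \<in> x_fractions K"
    then obtain m' n' p' q' b' where pq': "p' \<in> x_polys K m'" "q' \<in> x_polys K n'" "b' \<in> K"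
      "germ_le 1 (b' * q')" "g * q' = p'" "in_C_inf g"
      by (auto simp: x_fractions_def)
    have qq: "q * q' \<in> x_polys K (n + n')" "b * b' \<in> K" "germ_le 1 (b * b' * (q * q'))"
      by (rule x_polys_mult[OF pq(2) pq'(2)], rule hardy_field_closed(6)[OF pq(3) pq'(3)], rule prod[OF pq(4) pq'(4)])
    have "f * g * (q * q') = p * p'" "(f + g) * (q * q') = p * q' + p' * q"
      by (simp_all add: pq(5)[symmetric] pq'(5)[symmetric] algebra_simps)
    moreover have "p * p' \<in> x_polys K (m + m')" "p * q' + p' * q \<in> x_polys K (max (m + n') (m' + n))"
      by (rule x_polys_mult[OF pq(1) pq'(1)], intro x_polys_add)
        (rule x_polys_mono[OF x_polys_mult[OF pq(1) pq'(2)]], simp,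
         rule x_polys_mono[OF x_polys_mult[OF pq'(1) pq(2)]], simp)
    ultimately show "f + g \<in> x_fractions K" "f * g \<in> x_fractions K"
      using x_fractionsI[OF in_C_inf_add[OF \<open>in_C_inf f\<close> pq'(6)] _ qq]
        x_fractionsI[OF in_C_inf_mult[OF \<open>in_C_inf f\<close> pq'(6)] _ qq] by blast+
  qed
qed

lemma adjoin_x_subset: "adjoin_x K \<subseteq> x_fractions K"
proof -
  have "K \<subseteq> x_fractions K" "germ_x ^ 1 \<in> x_fractions K"
    using x_polys_subset_x_fractions const_in_x_polys xpow_in_x_polys[of 1] by blast+
  then show ?thesis
    unfolding adjoin_x_def using C_inf_subfield_x_fractions by auto
qed

text \<open>Multiplying by \<open>b * q\<close>, which is at least 1, does not decrease the absolute
  value and clears the denominator.\<close>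

lemma x_fractions_bound:
  assumes "f \<in> x_fractions K"
  obtains n u where "u \<in> x_polys K n" "germ_le f (germ_abs u)"
proof -
  obtain m n p q b where pq: "p \<in> x_polys K m" "q \<in> x_polys K n" "b \<in> K" "germ_le 1 (b * q)" "f * q = p"
    using assms by (auto simp: x_fractions_def)
  have "germ_le f (germ_abs (b * p))"
    using pq(4,5)
  proof transfer
    fix f b p q :: "real \<Rightarrow> real"
    assume "\<forall>\<^sub>F t in at_top. 1 \<le> b t * q t" "\<forall>\<^sub>F t in at_top. f t * q t = p t"
    then show "\<forall>\<^sub>F t in at_top. f t \<le> \<bar>b t * p t\<bar>"
    proof eventually_elim
      case (elim t)
      have "f t \<le> \<bar>f t\<bar> * (b t * q t)"
        using elim mult_left_mono[of 1 "b t * q t" "\<bar>f t\<bar>"] by linarith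
      also have "\<dots> = \<bar>f t * (b t * q t)\<bar>"
        unfolding abs_mult[of "f t" "b t * q t"] using elim by simp
      finally show ?case
        using elim by (simp add: ac_simps)
    qed
  qed
  with x_polys_scale[OF pq(3,1)] show ?thesis
    by (rule that)
qed

text \<open>Replace x by a and each coefficient c by \<open>c * c + 1\<close>, which dominates its
  absolute value and lies in K without a distinction of signs.\<close>

lemma x_polys_bound:
  assumes a: "a \<in> K" "germ_le germ_x a"
  shows "u \<in> x_polys K n \<Longrightarrow> \<exists>k\<in>K. germ_le (germ_abs u) k"
proof (induction n arbitrary: u)
  case 0
  moreover have "germ_le (germ_abs 0) 0"
    by transfer simp
  ultimately show ?case using hardy_field_closed by auto
next
  case (Suc n)
  then obtain c v where u: "u = c * germ_x ^ n + v" "c \<in> K" "v \<in> x_polys K n"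
    by (auto elim: x_polys_SucE)
  then obtain k where k: "k \<in> K" "germ_le (germ_abs v) k"
    using Suc.IH by blast
  have "germ_le (germ_abs u) ((c * c + 1) * a ^ n + k)"
    using a(2) k(2) unfolding u(1)
  proof (transfer fixing: n)
    fix a v k c :: "real \<Rightarrow> real"
    assume "\<forall>\<^sub>F t in at_top. t \<le> a t" "\<forall>\<^sub>F t in at_top. \<bar>v t\<bar> \<le> k t"
    with eventually_ge_at_top[of 0]
    show "\<forall>\<^sub>F t in at_top. \<bar>c t * t ^ n + v t\<bar> \<le> (c t * c t + 1) * a t ^ n + k t"
    proof eventually_elim
      case (elim t)
      have "0 \<le> (\<bar>c t\<bar> - 1/2)\<^sup>2"
        by simp
      then have "\<bar>c t\<bar> \<le> c t * c t + 1"
        by (simp add: power2_eq_square algebra_simps flip: abs_mult)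
      moreover have "t ^ n \<le> a t ^ n"
        using elim by (intro power_mono)
      ultimately have "\<bar>c t\<bar> * t ^ n \<le> (c t * c t + 1) * a t ^ n"
        using elim by (intro mult_mono) auto
      moreover have "\<bar>c t * t ^ n + v t\<bar> \<le> \<bar>c t\<bar> * t ^ n + \<bar>v t\<bar>"
        using elim abs_triangle_ineq[of "c t * t ^ n" "v t"] by (simp add: abs_mult)
      ultimately show ?case
        using elim by linarith
    qed
  qed
  moreover have "(c * c + 1) * a ^ n + k \<in> K"
    by (intro hardy_field_closed C_inf_subfield_power[OF hardy_field_subfield] u k a)
  ultimately show ?case ..
qed

text \<open>All coefficients are smaller than x in absolute value, so each of the n terms is
  eventually at most \<open>x ^ n\<close>.\<close>

lemma x_polys_bound_x:
  assumes less: "\<And>k. k \<in> K \<Longrightarrow> germ_less k germ_x"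
  shows "u \<in> x_polys K n \<Longrightarrow> germ_le (germ_abs u) (germ_const (real n) * germ_x ^ n)"
proof (induction n arbitrary: u)
  case 0
  then show ?case by simp (transfer, simp)
next
  case (Suc n)
  then obtain c v where u: "u = c * germ_x ^ n + v" "c \<in> K" "v \<in> x_polys K n"
    by (auto elim: x_polys_SucE)
  show ?case
    using Suc.IH[OF u(3)] less[OF u(2)] less[OF hardy_field_closed(5)[OF u(2)]] unfolding u(1)
  proof (transfer fixing: n)
    fix v c :: "real \<Rightarrow> real"
    assume "\<forall>\<^sub>F t in at_top. \<bar>v t\<bar> \<le> real n * t ^ n" "\<forall>\<^sub>F t in at_top. c t < t" "\<forall>\<^sub>F t in at_top. - c t < t"
    with eventually_ge_at_top[of 1]
    show "\<forall>\<^sub>F t in at_top. \<bar>c t * t ^ n + v t\<bar> \<le> real (Suc n) * t ^ Suc n"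
    proof eventually_elim
      case (elim t)
      have "\<bar>c t\<bar> * t ^ n \<le> t * t ^ n"
        using elim by (intro mult_right_mono) auto
      moreover have "real n * t ^ n \<le> real n * (t * t ^ n)"
        using elim mult_right_mono[of 1 t "t ^ n"] by (intro mult_left_mono) auto
      moreover have "\<bar>c t * t ^ n + v t\<bar> \<le> \<bar>c t\<bar> * t ^ n + \<bar>v t\<bar>"
        using elim abs_triangle_ineq[of "c t * t ^ n" "v t"] by (simp add: abs_mult)
      moreover have "real (Suc n) * t ^ Suc n = t * t ^ n + real n * (t * t ^ n)"
        by (simp add: algebra_simps)
      ultimately show ?case
        using elim by linarith
    qed
  qed
qed

text \<open>If no element of K were above x, fractions would grow at most polynomially, although
  \<open>exp x\<close> is one of them. So x is bounded by some a in K, and then so is every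
  fraction.\<close>

lemma cofinal_in_adjoin_x:
  assumes ex: "germ_exp ` adjoin_x K \<subseteq> adjoin_x K" and f: "f \<in> x_fractions K"
  shows "\<exists>k\<in>K. germ_le f k"
proof -
  have ex_x: "germ_exp germ_x \<in> x_fractions K"
    using ex adjoin_x_subset by (auto simp: adjoin_x_def)
  have "\<exists>a\<in>K. germ_le germ_x a"
  proof (rule ccontr)
    assume no: "\<not> ?thesis"
    have less: "germ_less k germ_x" if k: "k \<in> K" for k
    proof -
      \<comment> \<open>x and k are comparable because their difference is a polynomial in x, to
        which the lower bound gives a sign.\<close>
      have "germ_x - k \<in> x_polys K (Suc 1)"
        using xpow_in_x_polys[of 1] x_polys_mono[OF const_in_x_polys[OF hardy_field_closed(5)[OF k]], of "Suc 1"]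
          x_polys_add[of germ_x "Suc 1" "- k"] by simp
      then have "germ_x - k = 0 \<or> germ_less 0 (germ_x - k) \<or> germ_less (germ_x - k) 0"
        using x_polys_lower_bound germ_le_1_mult_cases by blast
      moreover have "germ_le germ_x k" if "germ_x - k = 0 \<or> germ_less (germ_x - k) 0"
      proof -
        have "germ_le (germ_x - k) 0"
          using that germ_less_imp_le germ_le_refl by metis
        then show ?thesis by transfer simp
      qed
      ultimately show ?thesis
        using no k germ_less_diff by blast
    qed
    obtain n u where "u \<in> x_polys K n" "germ_le (germ_exp germ_x) (germ_abs u)"
      using x_fractions_bound[OF ex_x] .
    then have "germ_le (germ_exp germ_x) (germ_abs u)" "germ_le (germ_abs u) (germ_const (real n) * germ_x ^ n)"
      using x_polys_bound_x less by blast+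
    then show False
    proof (transfer fixing: n)
      fix u :: "real \<Rightarrow> real"
      assume "\<forall>\<^sub>F t in at_top. exp t \<le> \<bar>u t\<bar>" "\<forall>\<^sub>F t in at_top. \<bar>u t\<bar> \<le> real n * t ^ n"
      moreover have "\<forall>\<^sub>F t in at_top. real n * t ^ n < exp (t :: real)"
      proof -
        have "((\<lambda>t :: real. real n * (t ^ n / exp t)) \<longlongrightarrow> real n * 0) at_top"
          by (intro tendsto_intros tendsto_power_div_exp_0)
        then have "\<forall>\<^sub>F t :: real in at_top. real n * (t ^ n / exp t) < 1"
          by (rule order_tendstoD) simp
        then show ?thesis
          by eventually_elim (simp add: field_simps)
      qed
      ultimately have "\<forall>\<^sub>F t :: real in at_top. False"
        by eventually_elim simp
      then show False by simp
    qed
  qed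
  then obtain a where a: "a \<in> K" "germ_le germ_x a"
    by blast
  obtain n u where u: "u \<in> x_polys K n" "germ_le f (germ_abs u)"
    using x_fractions_bound[OF f] .
  then obtain k where "k \<in> K" "germ_le (germ_abs u) k"
    using x_polys_bound[OF a] by blast
  with u(2) show ?thesis
    using germ_le_trans by blast
qed

lemma iexp_in_x_fractions:
  assumes "germ_exp ` adjoin_x K \<subseteq> adjoin_x K" and "h \<in> insert germ_x K"
  shows "(germ_exp ^^ n) h \<in> x_fractions K"
proof -
  have "h \<in> adjoin_x K"
    using assms(2) by (auto simp: adjoin_x_def)
  then have "(germ_exp ^^ n) h \<in> adjoin_x K"
    using assms(1) by (induction n) auto
  then show ?thesis
    using adjoin_x_subset by blast
qed

end

section \<open>Polynomial functions and iterated derivatives\<close>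

text \<open>Polynomials in n variables over H, encoded as functions on all sequences of germs and
  not only on sequences of successive derivatives. Substitution is then composition, and being
  nonzero means not vanishing at some sequence.\<close>

inductive_set poly_funs :: "germ set \<Rightarrow> nat \<Rightarrow> ((nat \<Rightarrow> germ) \<Rightarrow> germ) set"
  for H :: "germ set" and n :: nat where
  const: "c \<in> H \<Longrightarrow> (\<lambda>_. c) \<in> poly_funs H n"
| var: "i < n \<Longrightarrow> (\<lambda>v. v i) \<in> poly_funs H n"
| add: "F \<in> poly_funs H n \<Longrightarrow> G \<in> poly_funs H n \<Longrightarrow> (\<lambda>v. F v + G v) \<in> poly_funs H n"
| mult: "F \<in> poly_funs H n \<Longrightarrow> G \<in> poly_funs H n \<Longrightarrow> (\<lambda>v. F v * G v) \<in> poly_funs H n"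

lemma poly_funs_mono: "F \<in> poly_funs H m \<Longrightarrow> m \<le> n \<Longrightarrow> F \<in> poly_funs H n"
  by (induction rule: poly_funs.induct)
    (simp_all add: poly_funs.const poly_funs.var poly_funs.add poly_funs.mult)

lemma poly_funs_sum:
  assumes "0 \<in> H" and "\<And>i. i \<in> A \<Longrightarrow> F i \<in> poly_funs H n"
  shows "(\<lambda>v. \<Sum>i\<in>A. F i v) \<in> poly_funs H n"
  using assms(2)
  by (induction A rule: infinite_finite_induct) (simp_all add: poly_funs.const[OF assms(1)] poly_funs.add)

lemma poly_funs_prod:
  assumes "1 \<in> H" and "\<And>i. i \<in> A \<Longrightarrow> F i \<in> poly_funs H n"
  shows "(\<lambda>v. \<Prod>i\<in>A. F i v) \<in> poly_funs H n"
  using assms(2)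
  by (induction A rule: infinite_finite_induct) (simp_all add: poly_funs.const[OF assms(1)] poly_funs.mult)

lemma poly_funs_power:
  assumes "1 \<in> H" and "F \<in> poly_funs H n"
  shows "(\<lambda>v. F v ^ k) \<in> poly_funs H n"
  by (induction k) (simp_all add: poly_funs.const[OF assms(1)] poly_funs.mult[OF assms(2)])

section \<open>Polynomials over the ring of germs that vanish at integers\<close>

lemma of_nat_mult_germ_cancel: "of_nat (Suc k) * f = (0 :: germ) \<Longrightarrow> f = 0"
  unfolding of_nat_germ by (transfer, erule eventually_mono) simp

text \<open>The ring of germs has zero divisors, so roots cannot be counted in general. Here
  differences of the roots are nonzero integers, which can be cancelled, so a linear factor can be
  split off repeatedly.\<close>

lemma germ_poly_eq_0:
  fixes p :: "germ poly"
  assumes "degree p < n" and "\<And>k. k \<ge> a \<Longrightarrow> poly p (of_nat k) = 0"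
  shows "p = 0"
  using assms
proof (induction n arbitrary: p a)
  case (Suc n)
  define q where "q = synthetic_div p (of_nat a)"
  have p: "p = [:- of_nat a, 1:] * q"
    using synthetic_div_correct'[of "of_nat a" p] Suc.prems(2)[of a] by (simp add: q_def)
  show ?case
  proof (cases "degree p = 0")
    case True
    then obtain c where "p = [:c:]"
      by (rule degree_eq_zeroE)
    then show ?thesis using Suc.prems(2)[of a] by simp
  next
    case False
    have "poly q (of_nat k) = 0" if k: "k \<ge> Suc a" for k
    proof -
      obtain j where j: "k = Suc j + a"
        using k by (metis le_Suc_ex add.commute add_Suc_shift)
      have "(- of_nat a + of_nat k) * poly q (of_nat k) = 0"
        using Suc.prems(2)[of k] k unfolding p by (simp add: algebra_simps)
      then have "of_nat (Suc j) * poly q (of_nat k) = 0"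
        by (simp add: j)
      then show ?thesis by (rule of_nat_mult_germ_cancel)
    qed
    moreover have "degree q < n"
      using Suc.prems(1) False by (simp add: q_def degree_synthetic_div)
    ultimately have "q = 0"
      using Suc.IH by blast
    then show ?thesis using p by simp
  qed
qed simp

lemma poly_funs_update_var:
  assumes "F \<in> poly_funs H n"
  shows "\<exists>p. \<forall>T. F (v(j := T)) = poly p T"
  using assms
proof induction
  case (const c)
  show ?case by (rule exI[of _ "[:c:]"]) simp
next
  case (var i)
  show ?case
  proof (cases "i = j")
    case True
    then show ?thesis by (intro exI[of _ "[:0, 1:]"]) simp
  next
    case False
    then show ?thesis by (intro exI[of _ "[:v i:]"]) simp
  qed
next
  case (add F G)
  then show ?case by (metis poly_add)
next
  case (mult F G)
  then show ?case by (metis poly_mult)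
qed

text \<open>Moves a point of nonvanishing to one whose entry at 0 is a positive integer, hence a
  unit by which the sequence can be divided.\<close>

lemma poly_funs_nonzero_head:
  assumes "F \<in> poly_funs H n" and "F v \<noteq> 0"
  shows "\<exists>k\<ge>1. F (v(0 := of_nat k)) \<noteq> 0"
proof (rule ccontr)
  assume no: "\<not> ?thesis"
  obtain p where p: "\<And>T. F (v(0 := T)) = poly p T"
    using poly_funs_update_var[OF assms(1)] by metis
  have "p = 0"
  proof (rule germ_poly_eq_0)
    show "degree p < Suc (degree p)" by simp
    show "poly p (of_nat k) = 0" if "k \<ge> 1" for k
      using no that unfolding p by blast
  qed
  then have "F (v(0 := v 0)) = 0"
    unfolding p by simp
  with assms(2) show False by simp
qed

text \<open>
  If \<open>g' = g z\<close> then, by Leibniz' rule, \<open>g\<^sup>(\<^sup>i\<^sup>) = g R\<^sub>i\<close> for the following polynomials \<open>R\<^sub>i\<close>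
  in the derivatives \<open>w\<^sub>j = z\<^sup>(\<^sup>j\<^sup>)\<close>, \<open>j < i\<close>.
\<close>

fun riccati :: "nat \<Rightarrow> (nat \<Rightarrow> germ) \<Rightarrow> germ" where
  "riccati 0 w = 1"
| "riccati (Suc i) w = (\<Sum>k\<le>i. of_nat (i choose k) * riccati (i - k) w * w k)"

text \<open>In the recursion for \<open>riccati (Suc i) w\<close> the term \<open>w i\<close> has
  coefficient 1. Solving for it recovers w from prescribed values u.\<close>

fun riccati_inv :: "(nat \<Rightarrow> germ) \<Rightarrow> nat \<Rightarrow> germ" where
  "riccati_inv u i = u (Suc i) - (\<Sum>k<i. of_nat (i choose k) * u (i - k) * riccati_inv u k)"

declare riccati.simps(2) [simp del] riccati_inv.simps [simp del]

lemma riccati_riccati_inv: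
  assumes "u 0 = 1"
  shows "riccati i (riccati_inv u) = u i"
proof (induction i rule: less_induct)
  case (less i)
  show ?case
  proof (cases i)
    case (Suc j)
    have "riccati i (riccati_inv u) = (\<Sum>k\<le>j. of_nat (j choose k) * u (j - k) * riccati_inv u k)"
      unfolding Suc riccati.simps by (intro sum.cong) (simp_all add: less Suc)
    also have "\<dots> = (\<Sum>k<j. of_nat (j choose k) * u (j - k) * riccati_inv u k) + riccati_inv u j"
      by (simp add: assms flip: lessThan_Suc_atMost)
    also have "\<dots> = u i"
      by (simp add: riccati_inv.simps[of u j] Suc)
    finally show ?thesis .
  qed (simp add: assms)
qed

text \<open>The substitution \<open>v i = T * riccati i w\<close> reaches every sequence v whose
  entry \<open>v 0\<close> is a positive integer: take \<open>T = v 0\<close> and obtain w by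
  \<open>riccati_inv\<close> from v divided by \<open>v 0\<close>.\<close>

lemma poly_funs_nonzero_riccati:
  assumes "F \<in> poly_funs H n" and "F v \<noteq> 0"
  shows "\<exists>T w. F (\<lambda>i. T * riccati i w) \<noteq> 0"
proof -
  obtain k where k: "k \<ge> 1" "F (v(0 := of_nat k)) \<noteq> 0"
    using poly_funs_nonzero_head[OF assms] by (elim exE conjE)
  define v' where "v' = v(0 := of_nat k :: germ)"
  define S where "S = germ_const (1 / real k)"
  have S: "of_nat k * S = 1"
    unfolding of_nat_germ S_def using k(1) by (transfer fixing: k) simp
  define u where "u i = S * v' i" for i
  have u0: "u 0 = 1"
    using S by (simp add: u_def v'_def mult.commute)
  have "of_nat k * riccati i (riccati_inv u) = v' i" for i
    unfolding riccati_riccati_inv[of u, OF u0] unfolding u_def using S by (simp flip: mult.assoc)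
  then have "F (\<lambda>i. of_nat k * riccati i (riccati_inv u)) \<noteq> 0"
    using k(2) unfolding v'_def[symmetric] by simp
  then show ?thesis by blast
qed

text \<open>The index i in place of \<open>Suc i\<close> is the drop in order on which the main
  induction rests.\<close>

lemma riccati_poly_funs:
  assumes "C_inf_subfield H"
  shows "riccati i \<in> poly_funs H i"
proof (induction i rule: less_induct)
  case (less i)
  have H: "0 \<in> H" "1 \<in> H"
    using assms by (simp_all add: C_inf_subfield_def)
  show ?case
  proof (cases i)
    case 0
    then show ?thesis using poly_funs.const[OF H(2), of 0] by (simp add: riccati.simps(1)[abs_def])
  next
    case (Suc j)
    have "(\<lambda>w. \<Sum>k\<le>j. of_nat (j choose k) * riccati (j - k) w * w k) \<in> poly_funs H (Suc j)"
    proof (intro poly_funs_sum[OF H(1)] poly_funs.mult)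
      fix k assume "k \<in> {..j}"
      then show "(\<lambda>w. of_nat (j choose k)) \<in> poly_funs H (Suc j)" "(\<lambda>w. w k) \<in> poly_funs H (Suc j)"
        by (simp_all add: poly_funs.const poly_funs.var C_inf_subfield_of_nat[OF assms])
      have "riccati (j - k) \<in> poly_funs H (Suc j)"
        by (rule poly_funs_mono[OF less]) (auto simp: Suc)
      then show "(\<lambda>w. riccati (j - k) w) \<in> poly_funs H (Suc j)"
        by simp
    qed
    moreover have "riccati (Suc j) = (\<lambda>w. \<Sum>k\<le>j. of_nat (j choose k) * riccati (j - k) w * w k)"
      by (rule ext) (rule riccati.simps(2))
    ultimately show ?thesis
      by (simp add: Suc)
  qed
qed

text \<open>Substituting \<open>T * riccati i w\<close> and collecting powers of T trades one
  variable for T. The bound D is uniform in w, so only finitely many coefficient functions can be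
  nonzero.\<close>

lemma poly_funs_riccati_expansion:
  assumes H: "C_inf_subfield H" and "F \<in> poly_funs H (Suc n)"
  shows "\<exists>p D. (\<forall>w. degree (p w) \<le> D) \<and> (\<forall>d. (\<lambda>w. coeff (p w) d) \<in> poly_funs H n) \<and>
    (\<forall>T w. F (\<lambda>i. T * riccati i w) = poly (p w) T)"
  using assms(2)
proof induction
  have H0: "0 \<in> H"
    using H by (simp add: C_inf_subfield_def)
  {
    case (const c)
    show ?case
    proof (intro exI conjI allI)
      fix d show "(\<lambda>w. coeff [:c:] d) \<in> poly_funs H n"
        by (cases d) (auto intro: poly_funs.const const H0)
    qed auto
  next
    case (var i)
    show ?case
    proof (intro exI conjI allI)
      fix d
      have "(\<lambda>w. riccati i w) \<in> poly_funs H n"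
        using poly_funs_mono[OF riccati_poly_funs[OF H, of i], of n] var by simp
      moreover have "(\<lambda>w. coeff [:0, riccati i w:] d) = (if d = 1 then (\<lambda>w. riccati i w) else (\<lambda>_. 0))"
        by (auto simp: coeff_pCons fun_eq_iff split: nat.split)
      ultimately show "(\<lambda>w. coeff [:0, riccati i w:] d) \<in> poly_funs H n"
        by (simp add: poly_funs.const H0)
    next
      fix w show "degree [:0, riccati i w:] \<le> 1"
        by simp
    qed auto
  next
    case (add F G)
    then obtain p D q D' where
      p: "\<forall>w. degree (p w) \<le> D" "\<forall>d. (\<lambda>w. coeff (p w) d) \<in> poly_funs H n"
        "\<forall>T w. F (\<lambda>i. T * riccati i w) = poly (p w) T" and
      q: "\<forall>w. degree (q w) \<le> D'" "\<forall>d. (\<lambda>w. coeff (q w) d) \<in> poly_funs H n"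
        "\<forall>T w. G (\<lambda>i. T * riccati i w) = poly (q w) T"
      by blast
    show ?case
    proof (intro exI conjI allI)
      fix w show "degree (p w + q w) \<le> max D D'"
        using p(1) q(1) by (intro degree_add_le) (auto simp: le_max_iff_disj)
    next
      fix d show "(\<lambda>w. coeff (p w + q w) d) \<in> poly_funs H n"
        using p(2) q(2) by (auto intro: poly_funs.add)
    qed (simp add: p(3) q(3))
  next
    case (mult F G)
    then obtain p D q D' where
      p: "\<forall>w. degree (p w) \<le> D" "\<forall>d. (\<lambda>w. coeff (p w) d) \<in> poly_funs H n"
        "\<forall>T w. F (\<lambda>i. T * riccati i w) = poly (p w) T" and
      q: "\<forall>w. degree (q w) \<le> D'" "\<forall>d. (\<lambda>w. coeff (q w) d) \<in> poly_funs H n"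
        "\<forall>T w. G (\<lambda>i. T * riccati i w) = poly (q w) T"
      by blast
    show ?case
    proof (intro exI conjI allI)
      fix w show "degree (p w * q w) \<le> D + D'"
        using p(1) q(1) by (meson add_mono degree_mult_le order_trans)
    next
      fix d show "(\<lambda>w. coeff (p w * q w) d) \<in> poly_funs H n"
        using p(2) q(2) unfolding coeff_mult by (intro poly_funs_sum H0 poly_funs.mult) auto
    qed (simp add: p(3) q(3))
  }
qed

section \<open>Differential polynomials as polynomial functions\<close>

lemma digits_unique:
  fixes a b :: "nat \<Rightarrow> nat"
  assumes "\<And>i. a i < N" "\<And>i. b i < N" "(\<Sum>i<n. a i * N ^ i) = (\<Sum>i<n. b i * N ^ i)" "i < n"
  shows "a i = b i"
  using assms
proof (induction n arbitrary: a b i)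
  case (Suc n)
  have eq: "(\<Sum>i<Suc n. c i * N ^ i) = c 0 + N * (\<Sum>i<n. c (Suc i) * N ^ i)" for c :: "nat \<Rightarrow> nat"
    unfolding sum.lessThan_Suc_shift by (simp add: sum_distrib_left ac_simps)
  have "(a 0 + N * s) mod N = a 0" "(b 0 + N * s) mod N = b 0"
    "(a 0 + N * s) div N = s" "(b 0 + N * s) div N = s" for s
    using Suc.prems(1)[of 0] Suc.prems(2)[of 0] by simp_all
  then have "a 0 = b 0" "(\<Sum>i<n. a (Suc i) * N ^ i) = (\<Sum>i<n. b (Suc i) * N ^ i)"
    using Suc.prems(3) unfolding eq by metis+
  moreover from this(2) have "a (Suc j) = b (Suc j)" if "j < n" for j
    using Suc.IH[of "\<lambda>i. a (Suc i)" "\<lambda>i. b (Suc i)" j] Suc.prems(1,2) that by metis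
  ultimately show ?case
    using Suc.prems(4) by (cases i) simp_all
qed simp

text \<open>\<open>diff_poly_eval\<close> with the derivatives of y replaced by an arbitrary
  sequence, so that values unrelated by the derivation may be substituted.\<close>

definition diff_poly_fun :: "diff_poly \<Rightarrow> (nat \<Rightarrow> germ) \<Rightarrow> germ" where
  "diff_poly_fun P v = (\<Sum>m\<in>Poly_Mapping.keys P. Poly_Mapping.lookup P m *
     (\<Prod>i\<in>Poly_Mapping.keys m. v i ^ Poly_Mapping.lookup m i))"

lemma diff_poly_fun_poly_funs:
  assumes H: "C_inf_subfield H" and P: "\<And>m. Poly_Mapping.lookup P m \<in> H"
  shows "\<exists>n. diff_poly_fun P \<in> poly_funs H n"
proof -
  have "finite (\<Union>m\<in>Poly_Mapping.keys P. Poly_Mapping.keys m)"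
    by simp
  then obtain n where n: "\<And>m i. m \<in> Poly_Mapping.keys P \<Longrightarrow> i \<in> Poly_Mapping.keys m \<Longrightarrow> i < n"
    unfolding finite_nat_set_iff_bounded by blast
  have H01: "0 \<in> H" "1 \<in> H"
    using H by (simp_all add: C_inf_subfield_def)
  have "(\<lambda>v. diff_poly_fun P v) \<in> poly_funs H n"
    unfolding diff_poly_fun_def
    by (intro poly_funs_sum poly_funs.mult poly_funs_prod poly_funs_power poly_funs.const poly_funs.var
        H01 P n)
  then show ?thesis by blast
qed

text \<open>Kronecker substitution: \<open>v\<^sub>i = k ^ (N ^ i)\<close> sends distinct monomials to distinct powers of \<open>k\<close>.\<close>

lemma diff_poly_fun_nonzero:
  assumes "P \<noteq> 0"
  shows "\<exists>v. diff_poly_fun P v \<noteq> 0"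
proof (rule ccontr)
  assume no: "\<not> ?thesis"
  have "finite (\<Union>m\<in>Poly_Mapping.keys P. Poly_Mapping.keys m)"
    by simp
  then obtain n where n: "\<And>m i. m \<in> Poly_Mapping.keys P \<Longrightarrow> i \<in> Poly_Mapping.keys m \<Longrightarrow> i < n"
    unfolding finite_nat_set_iff_bounded by blast
  have "finite (insert 0 (\<Union>m\<in>Poly_Mapping.keys P. Poly_Mapping.lookup m ` Poly_Mapping.keys m))"
    by simp
  then obtain N where N: "\<forall>d\<in>insert 0 (\<Union>m\<in>Poly_Mapping.keys P. Poly_Mapping.lookup m ` Poly_Mapping.keys m). d < N"
    unfolding finite_nat_set_iff_bounded by blast
  have lN: "Poly_Mapping.lookup m i < N" if "m \<in> Poly_Mapping.keys P" for m i
  proof (cases "i \<in> Poly_Mapping.keys m")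
    case True
    then show ?thesis using N that by blast
  next
    case False
    then show ?thesis using N by (simp add: in_keys_iff)
  qed
  define e where "e m = (\<Sum>i<n. Poly_Mapping.lookup m i * N ^ i)" for m :: "nat \<Rightarrow>\<^sub>0 nat"
  have inj: "m = m'" if "m \<in> Poly_Mapping.keys P" "m' \<in> Poly_Mapping.keys P" "e m = e m'" for m m'
  proof (rule poly_mapping_eqI)
    fix i
    show "Poly_Mapping.lookup m i = Poly_Mapping.lookup m' i"
    proof (cases "i < n")
      case True
      then show ?thesis
        using digits_unique[of "Poly_Mapping.lookup m" N "Poly_Mapping.lookup m'" n i] lN that
        by (simp add: e_def)
    next
      case False
      then have "i \<notin> Poly_Mapping.keys m" "i \<notin> Poly_Mapping.keys m'"
        using n that by blast+
      then show ?thesis by (simp add: in_keys_iff)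
    qed
  qed
  define q where "q = (\<Sum>m\<in>Poly_Mapping.keys P. monom (Poly_Mapping.lookup P m) (e m))"
  have "poly q (of_nat k) = 0" for k
  proof -
    have "(\<Prod>i\<in>Poly_Mapping.keys m. (of_nat k ^ N ^ i) ^ Poly_Mapping.lookup m i) = (of_nat k :: germ) ^ e m"
      if "m \<in> Poly_Mapping.keys P" for m
    proof -
      have "(\<Prod>i\<in>Poly_Mapping.keys m. (of_nat k ^ N ^ i) ^ Poly_Mapping.lookup m i) =
        (\<Prod>i<n. (of_nat k ^ N ^ i) ^ Poly_Mapping.lookup m i :: germ)"
        using n that by (intro prod.mono_neutral_left) (auto simp: in_keys_iff)
      also have "\<dots> = (\<Prod>i<n. of_nat k ^ (Poly_Mapping.lookup m i * N ^ i))"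
        by (simp add: mult.commute flip: power_mult)
      also have "\<dots> = of_nat k ^ e m"
        by (simp add: e_def power_sum)
      finally show ?thesis .
    qed
    then have "poly q (of_nat k) = diff_poly_fun P (\<lambda>i. of_nat k ^ N ^ i)"
      by (simp add: q_def diff_poly_fun_def poly_sum poly_monom)
    then show ?thesis using no by simp
  qed
  then have q0: "q = 0"
    using germ_poly_eq_0[of q "Suc (degree q)" 0] by simp
  obtain m where m: "m \<in> Poly_Mapping.keys P"
    using assms by (metis keys_eq_empty ex_in_conv)
  have "coeff q (e m) = (\<Sum>m'\<in>Poly_Mapping.keys P. if m' = m then Poly_Mapping.lookup P m' else 0)"
    unfolding q_def coeff_sum coeff_monom using inj m by (intro sum.cong) auto
  also have "\<dots> = Poly_Mapping.lookup P m"
    using m by simp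
  finally show False
    using m q0 by (simp add: in_keys_iff)
qed

section \<open>Leibniz' rule and iterated derivatives through the logarithmic derivative\<close>

context
  fixes E :: "germ set"
  assumes E: "hardy_field E"
begin

lemma germ_deriv_sum:
  assumes "\<And>i. i \<in> A \<Longrightarrow> f i \<in> E"
  shows "germ_deriv (sum f A) = (\<Sum>i\<in>A. germ_deriv (f i))"
  using assms
proof (induction A rule: infinite_finite_induct)
  case (insert a A)
  then have "sum f A \<in> E" "f a \<in> E"
    using C_inf_subfield_sum[OF hardy_field_subfield[OF E], of A f] by auto
  then show ?case
    using insert by (simp add: germ_deriv_add hardy_field_closed(1)[OF E])
qed (use of_nat_germ[of 0] germ_deriv_const[of 0] in simp_all)

lemma funpow_germ_deriv_closed: "f \<in> E \<Longrightarrow> (germ_deriv ^^ n) f \<in> E"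
  by (induction n) (auto intro: hardy_field_closed(7)[OF E])

text \<open>Pascal's rule after an index shift; a and b stand for the sequences of derivatives of
  the two factors.\<close>

lemma leibniz_sum_Suc:
  fixes a b :: "nat \<Rightarrow> germ"
  shows "(\<Sum>k\<le>n. of_nat (n choose k) * (a (Suc (n - k)) * b k + a (n - k) * b (Suc k))) =
    (\<Sum>k\<le>Suc n. of_nat (Suc n choose k) * a (Suc n - k) * b k)"
proof -
  have "(\<Sum>k\<le>n. of_nat (n choose k) * (a (Suc (n - k)) * b k)) =
    (\<Sum>k\<le>Suc n. of_nat (n choose k) * (a (Suc n - k) * b k))"
    by (simp add: Suc_diff_le binomial_eq_0)
  also have "\<dots> = a (Suc n) * b 0 + (\<Sum>k\<le>n. of_nat (n choose Suc k) * (a (n - k) * b (Suc k)))"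
    by (subst sum.atMost_Suc_shift) (simp add: binomial_eq_0)
  finally have 1: "(\<Sum>k\<le>n. of_nat (n choose k) * (a (Suc (n - k)) * b k)) =
    a (Suc n) * b 0 + (\<Sum>k\<le>n. of_nat (n choose Suc k) * (a (n - k) * b (Suc k)))" .
  show ?thesis
    by (subst sum.atMost_Suc_shift)
      (simp add: distrib_left distrib_right sum.distrib 1 mult.assoc add.assoc add.commute)
qed

lemma germ_deriv_funpow_mult:
  assumes f: "f \<in> E" and g: "g \<in> E"
  shows "(germ_deriv ^^ n) (f * g) =
    (\<Sum>k\<le>n. of_nat (n choose k) * (germ_deriv ^^ (n - k)) f * (germ_deriv ^^ k) g)"
proof (induction n)
  case (Suc n)
  have mem: "of_nat j * (germ_deriv ^^ i) f * (germ_deriv ^^ k) g \<in> E" for i j k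
    by (intro hardy_field_closed(6)[OF E] C_inf_subfield_of_nat[OF hardy_field_subfield[OF E]] funpow_germ_deriv_closed f g)
  have D: "germ_deriv (of_nat j * (germ_deriv ^^ i) f * (germ_deriv ^^ k) g) =
    of_nat j * ((germ_deriv ^^ Suc i) f * (germ_deriv ^^ k) g + (germ_deriv ^^ i) f * (germ_deriv ^^ Suc k) g)"
    for i j k
  proof -
    have "in_C_inf ((germ_deriv ^^ i) f)" "in_C_inf ((germ_deriv ^^ k) g)"
      using f g funpow_germ_deriv_closed hardy_field_closed(1)[OF E] by blast+
    then show ?thesis
      unfolding of_nat_germ
      by (simp add: germ_deriv_mult in_C_inf_mult in_C_inf_const germ_deriv_const algebra_simps)
  qed
  have "(germ_deriv ^^ Suc n) (f * g) = (\<Sum>k\<le>n. of_nat (n choose k) *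
     ((germ_deriv ^^ Suc (n - k)) f * (germ_deriv ^^ k) g + (germ_deriv ^^ (n - k)) f * (germ_deriv ^^ Suc k) g))"
    unfolding D[symmetric] using mem by (simp add: Suc germ_deriv_sum)
  then show ?case
    using leibniz_sum_Suc[of n "\<lambda>i. (germ_deriv ^^ i) f" "\<lambda>i. (germ_deriv ^^ i) g"] by (simp only:)
qed simp

lemma funpow_germ_deriv_riccati:
  assumes g: "g \<in> E" and z: "z \<in> E" and gz: "germ_deriv g = g * z"
  shows "(germ_deriv ^^ i) g = g * riccati i (\<lambda>j. (germ_deriv ^^ j) z)"
proof (induction i rule: less_induct)
  case (less i)
  show ?case
  proof (cases i)
    case (Suc j)
    have "(germ_deriv ^^ i) g = (germ_deriv ^^ j) (g * z)"
      by (simp add: Suc funpow_swap1 gz)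
    also have "\<dots> = (\<Sum>k\<le>j. of_nat (j choose k) * (g * riccati (j - k) (\<lambda>j. (germ_deriv ^^ j) z)) * (germ_deriv ^^ k) z)"
      unfolding germ_deriv_funpow_mult[OF g z] by (intro sum.cong) (simp_all add: less Suc)
    also have "\<dots> = g * riccati i (\<lambda>j. (germ_deriv ^^ j) z)"
      by (simp add: Suc riccati.simps sum_distrib_left ac_simps)
    finally show ?thesis .
  qed simp
qed

end

section \<open>Growth of differentially algebraic germs\<close>

text \<open>Taking n = 0 puts g above H itself. The germ x is included because H may consist of
  constants, whose iterated exponentials are constant.\<close>

definition transexponential :: "germ set \<Rightarrow> germ \<Rightarrow> bool" where
  "transexponential H g \<longleftrightarrow> (\<forall>h\<in>insert germ_x H. \<forall>n. germ_less ((germ_exp ^^ n) h) g)"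

text \<open>In a Hardy field containing \<open>z > 2\<close>, the elements with this property form
  the convex subring generated by z.\<close>

definition power_bounded :: "germ \<Rightarrow> germ \<Rightarrow> bool" where
  "power_bounded z y \<longleftrightarrow> (\<exists>m. germ_le (germ_abs y) (z ^ m))"

lemma abs_zero_germ: "germ_abs 0 = 0"
  by transfer simp

lemma germ_less_exp: "germ_less f (germ_exp f)"
  by transfer (auto simp: exp_gt_self)

lemma germ_exp_pos: "germ_less 0 (germ_exp f)"
  by transfer simp

lemma germ_abs_le_iff: "germ_le (germ_abs f) g \<longleftrightarrow> germ_le f g \<and> germ_le (- f) g"
  by transfer (simp add: abs_le_iff eventually_conj_iff)

text \<open>One additional factor \<open>z > 2\<close> absorbs the sum of the two bounds.\<close>

lemma power_bounded_add:
  assumes "germ_less (germ_const 2) z" "power_bounded z f" "power_bounded z g"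
  shows "power_bounded z (f + g)"
proof -
  obtain m n where "germ_le (germ_abs f) (z ^ m)" "germ_le (germ_abs g) (z ^ n)"
    using assms by (auto simp: power_bounded_def)
  with assms(1) have "germ_le (germ_abs (f + g)) (z ^ Suc (m + n))"
  proof (transfer fixing: m n)
    fix z f g :: "real \<Rightarrow> real"
    assume "\<forall>\<^sub>F t in at_top. 2 < z t" "\<forall>\<^sub>F t in at_top. \<bar>f t\<bar> \<le> z t ^ m" "\<forall>\<^sub>F t in at_top. \<bar>g t\<bar> \<le> z t ^ n"
    then show "\<forall>\<^sub>F t in at_top. \<bar>f t + g t\<bar> \<le> z t ^ Suc (m + n)"
    proof eventually_elim
      case (elim t)
      have "z t ^ m \<le> z t ^ (m + n)" "z t ^ n \<le> z t ^ (m + n)" "0 \<le> z t ^ (m + n)"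
        using elim by (auto intro: power_increasing)
      moreover from this have "2 * z t ^ (m + n) \<le> z t * z t ^ (m + n)"
        using elim by (intro mult_right_mono) auto
      moreover have "z t ^ Suc (m + n) = z t * z t ^ (m + n)"
        by simp
      ultimately have "\<bar>f t\<bar> + \<bar>g t\<bar> \<le> z t ^ Suc (m + n)"
        using elim by linarith
      then show ?case
        using abs_triangle_ineq[of "f t" "g t"] by linarith
    qed
  qed
  then show ?thesis
    unfolding power_bounded_def by blast
qed

lemma power_bounded_mult:
  assumes "power_bounded z f" "power_bounded z g"
  shows "power_bounded z (f * g)"
proof -
  obtain m n where "germ_le (germ_abs f) (z ^ m)" "germ_le (germ_abs g) (z ^ n)"
    using assms by (auto simp: power_bounded_def)
  then have "germ_le (germ_abs (f * g)) (z ^ (m + n))"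
  proof (transfer fixing: m n)
    fix z f g :: "real \<Rightarrow> real"
    assume "\<forall>\<^sub>F t in at_top. \<bar>f t\<bar> \<le> z t ^ m" "\<forall>\<^sub>F t in at_top. \<bar>g t\<bar> \<le> z t ^ n"
    then show "\<forall>\<^sub>F t in at_top. \<bar>f t * g t\<bar> \<le> z t ^ (m + n)"
    proof eventually_elim
      case (elim t)
      have "\<bar>f t\<bar> * \<bar>g t\<bar> \<le> z t ^ m * z t ^ n"
        using elim by (intro mult_mono) auto
      then show ?case by (simp add: abs_mult power_add)
    qed
  qed
  then show ?thesis
    unfolding power_bounded_def by blast
qed

lemma power_bounded_le:
  assumes "germ_le f (z ^ m)" "germ_le (- f) (z ^ m)"
  shows "power_bounded z f"
  using assms germ_abs_le_iff unfolding power_bounded_def by blast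

lemma power_bounded_power: "power_bounded z f \<Longrightarrow> power_bounded z (f ^ n)"
proof (induction n)
  case 0
  have "germ_le (germ_abs 1) (z ^ 0)"
    by simp (transfer, simp)
  then have "germ_le (germ_abs (f ^ 0)) (z ^ 0)"
    by simp
  then show ?case unfolding power_bounded_def by (rule exI)
qed (simp add: power_bounded_mult)

lemma power_bounded_self:
  assumes "germ_less (germ_const 2) z"
  shows "power_bounded z z"
proof -
  have "germ_le (germ_abs z) (z ^ 1)"
    using assms by simp (transfer, erule eventually_mono, simp)
  then show ?thesis
    unfolding power_bounded_def by (rule exI)
qed

text \<open>Horner's scheme: let \<open>a + g * q\<close> have
  \<open>\<bar>q\<bar> * z \<ge> 1\<close> and \<open>\<bar>a\<bar> \<le> z ^ m\<close>. Then
  \<open>\<bar>g * q\<bar> * z \<ge> g \<ge> 2 * z ^ (m + 1)\<close>, while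
  \<open>\<bar>a\<bar> * z\<close> is at most \<open>z ^ (m + 1)\<close>. The lower bound 1/z thus
  passes unchanged from the leading coefficient to the whole value.\<close>

lemma poly_lower_bound:
  assumes z: "germ_less (germ_const 2) z" and zg: "\<And>m. germ_less (z ^ m) g"
  shows "p \<noteq> 0 \<Longrightarrow> (\<And>d. power_bounded z (coeff p d)) \<Longrightarrow>
    germ_le 1 (germ_abs (lead_coeff p) * z) \<Longrightarrow> germ_le 1 (germ_abs (poly p g) * z)"
proof (induction p)
  case (pCons a p)
  show ?case
  proof (cases "p = 0")
    case True
    then show ?thesis using pCons.prems by simp
  next
    case False
    define q where "q = poly p g"
    have q: "germ_le 1 (germ_abs q * z)"
      using pCons.IH pCons.prems(2)[of "Suc _"] pCons.prems(3) False by (simp add: q_def)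
    obtain m where "germ_le (germ_abs a) (z ^ m)"
      using pCons.prems(2)[of 0] by (auto simp: power_bounded_def)
    with z q zg[of "m + 2"] have "germ_le 1 (germ_abs (a + g * q) * z)"
    proof (transfer fixing: m)
      fix z g a q :: "real \<Rightarrow> real"
      assume "\<forall>\<^sub>F t in at_top. 2 < z t" "\<forall>\<^sub>F t in at_top. 1 \<le> \<bar>q t\<bar> * z t"
        "\<forall>\<^sub>F t in at_top. z t ^ (m + 2) < g t" "\<forall>\<^sub>F t in at_top. \<bar>a t\<bar> \<le> z t ^ m"
      then show "\<forall>\<^sub>F t in at_top. 1 \<le> \<bar>a t + g t * q t\<bar> * z t"
      proof eventually_elim
        case (elim t)
        have zm: "1 \<le> z t ^ Suc m"
          using elim by (intro one_le_power) auto
        have "2 * z t ^ Suc m \<le> z t * z t ^ Suc m"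
          using elim zm by (intro mult_right_mono) auto
        moreover have "z t ^ (m + 2) = z t * z t ^ Suc m"
          by simp
        ultimately have 1: "2 * z t ^ Suc m \<le> g t"
          using elim by linarith
        have "g t * 1 \<le> g t * (\<bar>q t\<bar> * z t)"
          using elim 1 zm by (intro mult_left_mono) auto
        then have 2: "g t \<le> \<bar>g t * q t\<bar> * z t"
          using 1 zm by (simp add: abs_mult mult.assoc)
        have 3: "\<bar>a t\<bar> * z t \<le> z t ^ Suc m"
          using elim mult_right_mono[of "\<bar>a t\<bar>" "z t ^ m" "z t"] by (simp add: mult.commute)
        have "(\<bar>g t * q t\<bar> - \<bar>a t\<bar>) * z t \<le> \<bar>a t + g t * q t\<bar> * z t"
          using elim by (intro mult_right_mono) auto
        then show ?case
          using 1 2 3 zm by (simp add: left_diff_distrib)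
      qed
    qed
    then show ?thesis by (simp add: q_def)
  qed
qed simp

lemma germ_le_1_abs_mult_mono: "germ_le 1 (germ_abs q * z) \<Longrightarrow> germ_less z g \<Longrightarrow> germ_le 1 (germ_abs q * g)"
proof transfer
  fix z g q :: "real \<Rightarrow> real"
  assume "\<forall>\<^sub>F t in at_top. 1 \<le> \<bar>q t\<bar> * z t" "\<forall>\<^sub>F t in at_top. z t < g t"
  then show "\<forall>\<^sub>F t in at_top. 1 \<le> \<bar>q t\<bar> * g t"
  proof eventually_elim
    case (elim t)
    have "\<bar>q t\<bar> * z t \<le> \<bar>q t\<bar> * g t"
      using elim by (intro mult_left_mono) auto
    then show ?case using elim by linarith
  qed
qed

lemma poly_funs_0_const: "F \<in> poly_funs H 0 \<Longrightarrow> C_inf_subfield H \<Longrightarrow> \<exists>c\<in>H. F = (\<lambda>_. c)"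
proof (induction rule: poly_funs.induct)
  case (add F G)
  then show ?case unfolding C_inf_subfield_def by fastforce
next
  case (mult F G)
  then show ?case unfolding C_inf_subfield_def by fastforce
qed auto

section \<open>Transexponential germs do not satisfy differential equations over H\<close>

context
  fixes H E :: "germ set"
  assumes H: "hardy_field H" and E: "hardy_field E" and HE: "H \<subseteq> E"
    and ex: "germ_exp ` adjoin_x E \<subseteq> adjoin_x E"
begin

text \<open>Both germs lie in the field \<open>x_fractions E\<close>, the iterates because E(x) is
  closed under exp, and elements of a field of such germs are comparable.\<close>

lemma iexp_linear:
  assumes "h \<in> insert germ_x H" and "g \<in> E"
  shows "germ_less ((germ_exp ^^ n) h) g \<or> germ_le g ((germ_exp ^^ n) h)"
proof -
  have "(germ_exp ^^ n) h \<in> x_fractions E"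
    using iexp_in_x_fractions[OF E ex] assms(1) HE by blast
  moreover have "g \<in> x_fractions E"
    using adjoin_x_subset[OF E] assms(2) by (auto simp: adjoin_x_def)
  ultimately show ?thesis
    using C_inf_subfield_linear[OF C_inf_subfield_x_fractions[OF E]] by blast
qed

lemma deriv_sign_cases:
  assumes "h \<in> insert germ_x H"
  shows "in_C_inf h \<and> (germ_le 0 (germ_deriv h) \<or> germ_le (germ_deriv h) 0)"
proof (cases "h = germ_x")
  case True
  have "germ_le 0 1"
    by transfer simp
  then show ?thesis
    using True by (simp add: in_C_inf_x germ_deriv_x)
next
  case False
  then have h: "h \<in> H"
    using assms by simp
  then show ?thesis
    using C_inf_subfield_linear[OF hardy_field_subfield[OF H] hardy_field_closed(2)[OF H] hardy_field_closed(7)[OF H h]]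
      germ_less_imp_le hardy_field_closed(1)[OF H h] by blast
qed

lemma transexponential_pos:
  assumes "transexponential H g"
  shows "germ_less 0 g"
proof -
  have "germ_less (germ_exp germ_x) g"
    using assms unfolding transexponential_def by (metis funpow_0 funpow_simps_right(2) insertI1 comp_apply)
  then show ?thesis
    using germ_exp_pos germ_less_trans by blast
qed

lemma transexponential_gt:
  assumes "transexponential H g" "h \<in> H"
  shows "germ_less h g"
  using assms unfolding transexponential_def by (metis funpow_0 insertI2)

lemma transexponential_gt_2:
  assumes "transexponential H g"
  shows "germ_less (germ_const 2) g"
  using transexponential_gt[OF assms C_inf_subfield_of_nat[OF hardy_field_subfield[OF H], of 2]] of_nat_germ[of 2] by simp

text \<open>The germ z is g'/g. It inherits transexponentiality by
  \<open>germ_log_deriv_iexp_False\<close>, and g exceeds its powers by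
  \<open>germ_log_deriv_power_False\<close>; comparability turns both refutations into strict
  inequalities.\<close>

lemma transexponential_log_deriv:
  assumes g: "g \<in> E" and tr: "transexponential H g"
  obtains z where "z \<in> E" "germ_deriv g = g * z" "transexponential H z" "\<And>m. germ_less (z ^ m) g"
proof -
  have "g \<noteq> 0"
    using transexponential_pos[OF tr] germ_less_irrefl by auto
  then obtain r where r: "r \<in> E" "g * r = 1"
    using hardy_field_inverse[OF E g] by blast
  define z where "z = germ_deriv g * r"
  have z: "z \<in> E"
    unfolding z_def by (intro hardy_field_closed(6)[OF E] hardy_field_closed(7)[OF E] g r)
  have "g * z = germ_deriv g * (g * r)"
    by (simp add: z_def ac_simps)
  then have gz: "germ_deriv g = g * z"
    using r by simp
  have trz: "transexponential H z"
    unfolding transexponential_def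
  proof (intro ballI allI)
    fix h n assume h: "h \<in> insert germ_x H"
    \<comment> \<open>The analytic estimate is stated for \<open>Suc n\<close>, where the iterate is
      positive; level n lies below it since \<open>f < exp f\<close>.\<close>
    have "\<not> germ_le z ((germ_exp ^^ Suc n) h)"
    proof
      assume "germ_le z ((germ_exp ^^ Suc n) h)"
      moreover have "germ_less ((germ_exp ^^ Suc (Suc (Suc n))) h) g" "germ_less ((germ_exp ^^ 2) germ_x) g"
        using tr h unfolding transexponential_def by blast+
      ultimately show False
        using germ_log_deriv_iexp_False[OF hardy_field_closed(1)[OF E g] _ _ gz] deriv_sign_cases[OF h] by blast
    qed
    then have "germ_less ((germ_exp ^^ Suc n) h) z"
      using iexp_linear[OF h z] by blast
    moreover have "germ_less ((germ_exp ^^ n) h) ((germ_exp ^^ Suc n) h)"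
      by (simp add: germ_less_exp)
    ultimately show "germ_less ((germ_exp ^^ n) h) z"
      using germ_less_trans by blast
  qed
  have "germ_less (z ^ m) g" for m
  proof (cases m)
    case 0
    then show ?thesis
      using transexponential_gt[OF tr hardy_field_closed(3)[OF H]] by simp
  next
    case (Suc k)
    have "z ^ Suc k \<in> E"
      by (rule C_inf_subfield_power[OF hardy_field_subfield[OF E] z])
    then show ?thesis
      using C_inf_subfield_linear[OF hardy_field_subfield[OF E] _ g, of "z ^ Suc k"] Suc
        germ_log_deriv_power_False[OF hardy_field_closed(1)[OF E g] transexponential_pos[OF tr] gz
          transexponential_pos[OF trz], of k] by blast
  qed
  with z gz trz show ?thesis
    by (rule that)
qed

text \<open>By comparability a derivative not bounded by 1 would eventually exceed 1, and its
  antiderivative could not stay bounded.\<close>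

lemma germ_abs_deriv_le_1:
  assumes w: "w \<in> E" and "germ_le (germ_abs w) 1"
  shows "germ_le (germ_abs (germ_deriv w)) 1"
proof -
  have *: "germ_le (germ_deriv u) 1" if u: "u \<in> E" "germ_le u 1" for u
    using C_inf_subfield_linear[OF hardy_field_subfield[OF E] hardy_field_closed(3)[OF E] hardy_field_closed(7)[OF E u(1)]]
      germ_bounded_deriv_False[OF hardy_field_closed(1)[OF E u(1)] u(2)] by blast
  have "germ_le (germ_deriv w) 1" "germ_le (germ_deriv (- w)) 1"
    using assms(2) germ_abs_le_iff by (auto intro!: * w hardy_field_closed(5)[OF E])
  then show ?thesis
    by (simp add: germ_abs_le_iff germ_deriv_uminus hardy_field_closed(1)[OF E w])
qed

text \<open>The inverse s of z is bounded by 1, hence so is s', and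
  \<open>z' = - z * z * s'\<close>. In general \<open>y = z ^ m * w\<close> with
  \<open>w = s ^ m * y\<close> bounded by 1, and the product rule applies.\<close>

lemma power_bounded_deriv:
  assumes z: "z \<in> E" "transexponential H z" and y: "y \<in> E" "power_bounded z y"
  shows "power_bounded z (germ_deriv y)"
proof -
  note z2 = transexponential_gt_2[OF z(2)]
  have "z \<noteq> 0"
    using transexponential_pos[OF z(2)] germ_less_irrefl by auto
  then obtain s where s: "s \<in> E" "z * s = 1"
    using hardy_field_inverse[OF E z(1)] by blast
  have bdd: "power_bounded z (germ_deriv w)" if "w \<in> E" "germ_le (germ_abs w) 1" for w
    using germ_abs_deriv_le_1[OF that] unfolding power_bounded_def by (metis power_0)
  have bdd': "power_bounded z w" if "germ_le (germ_abs w) 1" for w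
    using that unfolding power_bounded_def by (metis power_0)
  have s1: "germ_le (germ_abs (s ^ m * u)) 1" if "germ_le (germ_abs u) (z ^ m)" for m u
    using that z2 s(2)
  proof (transfer fixing: m)
    fix u z s :: "real \<Rightarrow> real"
    assume "\<forall>\<^sub>F t in at_top. \<bar>u t\<bar> \<le> z t ^ m" "\<forall>\<^sub>F t in at_top. 2 < z t" "\<forall>\<^sub>F t in at_top. z t * s t = 1"
    then show "\<forall>\<^sub>F t in at_top. \<bar>s t ^ m * u t\<bar> \<le> 1"
    proof eventually_elim
      case (elim t)
      have "0 < z t * s t"
        using elim by simp
      then have "s t > 0"
        by (rule zero_less_mult_pos) (use elim in simp)
      then have "\<bar>s t ^ m * u t\<bar> \<le> s t ^ m * z t ^ m"
        using elim by (simp add: abs_mult)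
      also have "\<dots> = 1"
        using elim by (simp flip: power_mult_distrib add: mult.commute)
      finally show ?case .
    qed
  qed
  have "germ_le (germ_abs 1) (z ^ 0)"
    by simp (transfer, simp)
  from s1[OF this] have "germ_le (germ_abs 1) 1"
    by simp
  note zb = power_bounded_self[OF z2]
  have "power_bounded z (germ_deriv z)"
  proof -
    have "germ_le (germ_abs 1) (z ^ 1)"
      using z2 by simp (transfer, erule eventually_mono, simp)
    from s1[OF this] have "power_bounded z (germ_deriv s)"
      using bdd[OF s(1)] by simp
    then have "power_bounded z ((- 1) * (z * (z * germ_deriv s)))"
      using bdd'[of "- 1"] \<open>germ_le (germ_abs 1) 1\<close> zb
      by (intro power_bounded_mult) (auto simp: germ_abs_le_iff)
    moreover have "germ_deriv (z * s) = 0"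
      using s(2) of_nat_germ[of 1] germ_deriv_const[of 1] by simp
    then have "germ_deriv z * s = - (z * germ_deriv s)"
      using z(1) s(1) by (simp add: germ_deriv_mult hardy_field_closed(1)[OF E] eq_neg_iff_add_eq_0)
    then have "z * (germ_deriv z * s) = (- 1) * (z * (z * germ_deriv s))"
      by (simp add: algebra_simps)
    moreover have "z * (germ_deriv z * s) = germ_deriv z * (z * s)"
      by (simp add: ac_simps)
    ultimately show ?thesis
      using s(2) by simp
  qed
  then have zm: "power_bounded z (germ_deriv (z ^ m))" for m
  proof (induction m)
    case 0
    have "germ_deriv (z ^ 0) = 0"
      using of_nat_germ[of 1] germ_deriv_const[of 1] by simp
    moreover have "germ_le (germ_abs 0) 1"
      by transfer simp
    ultimately show ?case using bdd' by simp
  next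
    case (Suc m)
    have "in_C_inf z" "in_C_inf (z ^ m)"
      using z(1) C_inf_subfield_power[OF hardy_field_subfield[OF E] z(1)] hardy_field_closed(1)[OF E] by blast+
    then have "germ_deriv (z ^ Suc m) = germ_deriv z * z ^ m + z * germ_deriv (z ^ m)"
      by (simp add: germ_deriv_mult)
    then show ?case
      using Suc zb by (simp add: power_bounded_add[OF z2] power_bounded_mult power_bounded_power)
  qed
  obtain m where "germ_le (germ_abs y) (z ^ m)"
    using y(2) by (auto simp: power_bounded_def)
  from s1[OF this] have w: "germ_le (germ_abs (s ^ m * y)) 1" .
  have wE: "s ^ m * y \<in> E"
    by (intro hardy_field_closed(6)[OF E] C_inf_subfield_power[OF hardy_field_subfield[OF E]] s y)
  have "z ^ m * (s ^ m * y) = (z * s) ^ m * y"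
    by (simp add: power_mult_distrib ac_simps)
  then have yeq: "y = z ^ m * (s ^ m * y)"
    using s(2) by simp
  have "germ_deriv y = germ_deriv (z ^ m) * (s ^ m * y) + z ^ m * germ_deriv (s ^ m * y)"
    by (subst yeq, rule germ_deriv_mult)
      (use wE C_inf_subfield_power[OF hardy_field_subfield[OF E] z(1)] hardy_field_closed(1)[OF E] in blast)+
  then show ?thesis
    using zm[of m] bdd[OF wE w] bdd'[OF w] zb
    by (simp add: power_bounded_add[OF z2] power_bounded_mult power_bounded_power)
qed

lemma poly_funs_power_bounded:
  assumes z: "z \<in> E" "transexponential H z" and "F \<in> poly_funs H n"
  shows "power_bounded z (F (\<lambda>i. (germ_deriv ^^ i) z))"
  using assms(3)
proof induction
  note z2 = transexponential_gt_2[OF z(2)]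
  {
    case (const c)
    have "germ_less c (z ^ 1)" "germ_less (- c) (z ^ 1)"
      using transexponential_gt[OF z(2)] const hardy_field_closed(5)[OF H] by simp_all
    then show ?case
      by (intro power_bounded_le germ_less_imp_le)
  next
    case (var i)
    show ?case
    proof (induction i)
      case 0
      show ?case
        using power_bounded_self[OF z2] by simp
    next
      case (Suc i)
      then show ?case
        using power_bounded_deriv[OF z funpow_germ_deriv_closed[OF E z(1)]] by simp
    qed
  next
    case (add F G)
    then show ?case by (intro power_bounded_add[OF z2])
  next
    case (mult F G)
    then show ?case by (intro power_bounded_mult)
  }
qed

text \<open>Induction on the number of variables, for all transexponential g at once: F at the
  derivatives of g becomes a polynomial in g whose coefficients, in one variable fewer, are
  evaluated at the derivatives of z = g'/g. The induction hypothesis for z bounds the leading one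
  below by 1/z, and all of them are power bounded in z, so the leading term dominates.\<close>

lemma transexponential_poly_fun_bound:
  "g \<in> E \<Longrightarrow> transexponential H g \<Longrightarrow> F \<in> poly_funs H n \<Longrightarrow> F v \<noteq> 0 \<Longrightarrow>
    germ_le 1 (germ_abs (F (\<lambda>i. (germ_deriv ^^ i) g)) * g)"
proof (induction n arbitrary: g F v)
  case 0
  obtain c where c: "c \<in> H" "F = (\<lambda>_. c)"
    using poly_funs_0_const[OF 0(3) hardy_field_subfield[OF H]] by blast
  then obtain r where r: "r \<in> H" "c * r = 1"
    using hardy_field_inverse[OF H] 0(4) by blast
  have "germ_less r g" "germ_less (- r) g"
    using transexponential_gt[OF 0(2)] r hardy_field_closed(5)[OF H] by blast+
  with r(2) have "germ_le 1 (germ_abs c * g)"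
  proof transfer
    fix r g c :: "real \<Rightarrow> real"
    assume "\<forall>\<^sub>F t in at_top. c t * r t = 1" "\<forall>\<^sub>F t in at_top. r t < g t" "\<forall>\<^sub>F t in at_top. - r t < g t"
    then show "\<forall>\<^sub>F t in at_top. 1 \<le> \<bar>c t\<bar> * g t"
    proof eventually_elim
      case (elim t)
      have "\<bar>c t\<bar> * \<bar>r t\<bar> = 1"
        using elim by (simp flip: abs_mult)
      moreover have "\<bar>c t\<bar> * \<bar>r t\<bar> \<le> \<bar>c t\<bar> * g t"
        using elim by (intro mult_left_mono) auto
      ultimately show ?case by simp
    qed
  qed
  then show ?case
    by (simp add: c(2))
next
  case (Suc n)
  obtain z where z: "z \<in> E" "germ_deriv g = g * z" "transexponential H z" "\<And>m. germ_less (z ^ m) g"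
    using transexponential_log_deriv[OF Suc.prems(1,2)] by blast
  define w where "w = (\<lambda>j. (germ_deriv ^^ j) z)"
  obtain p D where p: "\<And>w. degree (p w) \<le> D" "\<And>d. (\<lambda>w. coeff (p w) d) \<in> poly_funs H n"
    "\<And>T w. F (\<lambda>i. T * riccati i w) = poly (p w) T"
    using poly_funs_riccati_expansion[OF hardy_field_subfield[OF H] Suc.prems(3)] by blast
  have Fg: "F (\<lambda>i. (germ_deriv ^^ i) g) = poly (p w) g"
    unfolding p(3)[symmetric] w_def funpow_germ_deriv_riccati[OF E Suc.prems(1) z(1,2)] ..
  \<comment> \<open>Indices of coefficients that are nonzero as functions of the sequence. At the
    largest such index the induction hypothesis shows that the coefficient is nonzero at w too, so
    this index is the degree of \<open>p w\<close>.\<close>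
  define S where "S = {d. \<exists>u. coeff (p u) d \<noteq> 0}"
  obtain T u where "poly (p u) T \<noteq> 0"
    using poly_funs_nonzero_riccati[OF Suc.prems(3,4)] p(3) by metis
  then have "p u \<noteq> 0"
    by auto
  then have "coeff (p u) (degree (p u)) \<noteq> 0"
    by simp
  then have "S \<noteq> {}"
    unfolding S_def by blast
  have "S \<subseteq> {..D}"
    unfolding S_def using p(1) le_degree order_trans by fastforce
  then have fin: "finite S"
    using finite_subset by blast
  define d where "d = Max S"
  have "d \<in> S"
    unfolding d_def using fin \<open>S \<noteq> {}\<close> by (rule Max_in)
  then obtain u' where "coeff (p u') d \<noteq> 0"
    unfolding S_def by blast
  then have lc: "germ_le 1 (germ_abs (coeff (p w) d) * z)"
    unfolding w_def using Suc.IH[OF z(1,3) p(2)] by blast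
  then have "coeff (p w) d \<noteq> 0"
    by (metis (no_types) abs_zero_germ mult_zero_left not_germ_le_1_0)
  moreover have "coeff (p w) e = 0" if "e > d" for e
  proof (rule ccontr)
    assume "coeff (p w) e \<noteq> 0"
    then have "e \<in> S"
      unfolding S_def by blast
    then show False
      using Max_ge[OF fin, of e] that by (simp add: d_def)
  qed
  ultimately have "degree (p w) = d"
    by (intro antisym degree_le le_degree) auto
  with lc have lc': "germ_le 1 (germ_abs (lead_coeff (p w)) * z)"
    by simp
  have "power_bounded z (coeff (p w) e)" for e
    unfolding w_def using poly_funs_power_bounded[OF z(1,3) p(2)] .
  moreover have "p w \<noteq> 0"
    using \<open>coeff (p w) d \<noteq> 0\<close> by auto
  ultimately have "germ_le 1 (germ_abs (poly (p w) g) * z)"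
    using poly_lower_bound[OF transexponential_gt_2[OF z(3)] z(4), of "p w"] lc' by blast
  then show ?case
    unfolding Fg using z(4)[of 1] by (simp add: germ_le_1_abs_mult_mono)
qed

theorem diff_algebraic_growth:
  assumes alg: "diff_algebraic_over E H" and g: "g \<in> E"
  shows "\<exists>h\<in>insert germ_x H. \<exists>n. germ_le g ((germ_exp ^^ n) h)"
proof -
  obtain P :: diff_poly where P: "P \<noteq> 0" "\<And>m. Poly_Mapping.lookup P m \<in> H" "diff_poly_eval P g = 0"
    using alg g unfolding diff_algebraic_over_def by blast
  obtain n where n: "diff_poly_fun P \<in> poly_funs H n"
    using diff_poly_fun_poly_funs[OF hardy_field_subfield[OF H] P(2)] by blast
  obtain v where v: "diff_poly_fun P v \<noteq> 0"
    using diff_poly_fun_nonzero[OF P(1)] by blast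
  have "diff_poly_fun P (\<lambda>i. (germ_deriv ^^ i) g) = 0"
    using P(3) by (simp add: diff_poly_fun_def diff_poly_eval_def)
  then have "\<not> transexponential H g"
    using transexponential_poly_fun_bound[OF g _ n v] abs_zero_germ not_germ_le_1_0 by auto
  then show ?thesis
    using iexp_linear[OF _ g] unfolding transexponential_def by blast
qed

end

section \<open>Cofinality and cardinality\<close>

text \<open>Well-order B by its cardinal and keep the set A of those elements that lie above all
  their predecessors. The least element of B above a given x is in A, so A is cofinal, and on A the
  order r coincides with the well-order.\<close>

lemma cofinality_le_card_of:
  assumes r: "Linear_order r" and B: "cofinal_subset r B"
  shows "cofinality r \<le>o |B|"
proof -
  define w where "w = |B|"
  have wo: "well_order_on B w"
    unfolding w_def by (rule card_of_well_order_on)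
  then have W: "Well_order w" and Fw: "Field w = B"
    using well_order_on_Well_order by blast+
  have wf: "wf (w - Id)" and wtot: "total_on B w" and wrefl: "refl_on B w"
    using wo by (auto simp: order_on_defs)
  have rr: "refl_on (Field r) r" "trans r" "antisym r" "total_on (Field r) r"
    using r by (auto simp: order_on_defs)
  have Br: "B \<subseteq> Field r"
    using B by (simp add: cofinal_subset_def)
  define A where "A = {a \<in> B. \<forall>b. (b, a) \<in> w - Id \<longrightarrow> (b, a) \<in> r}"
  have "\<exists>a\<in>A. (x, a) \<in> r" if x: "x \<in> Field r" for x
  proof -
    obtain c where c: "c \<in> {y \<in> B. (x, y) \<in> r}"
      using B x unfolding cofinal_subset_def by blast
    obtain y where "y \<in> {y \<in> B. (x, y) \<in> r}"
      and "\<And>b. (b, y) \<in> w - Id \<Longrightarrow> b \<notin> {y \<in> B. (x, y) \<in> r}"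
      using wfE_min[OF wf c] by blast
    then have y: "y \<in> B" "(x, y) \<in> r" and miny: "\<And>b. (b, y) \<in> w - Id \<Longrightarrow> b \<in> B \<Longrightarrow> (x, b) \<notin> r"
      by simp_all
    have "(b, y) \<in> r" if b: "(b, y) \<in> w - Id" for b
    proof -
      have bB: "b \<in> B"
        using b Fw by (auto simp: Field_def)
      then have "(x, b) \<notin> r"
        using miny b by blast
      then have "(b, x) \<in> r"
        using rr(1,4) x bB Br by (metis total_on_def refl_onD subsetD)
      then show ?thesis
        using y rr(2) by (auto dest: transD)
    qed
    then show ?thesis
      using y by (auto simp: A_def)
  qed
  moreover have AB: "A \<subseteq> B"
    by (auto simp: A_def)
  ultimately have cof: "cofinal_subset r A"
    using Br by (auto simp: cofinal_subset_def)
  have eq: "Restr r A = Restr w A"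
  proof (intro equalityI subrelI)
    fix a b assume ab: "(a, b) \<in> Restr r A"
    have "(a, b) \<in> w"
    proof (rule ccontr)
      assume no: "(a, b) \<notin> w"
      moreover have "a \<in> B" "b \<in> B"
        using ab AB by auto
      ultimately have "(b, a) \<in> w - Id"
        using no wtot wrefl unfolding total_on_def refl_on_def by (metis DiffI pair_in_Id_conv)
      then have "(b, a) \<in> r" "a \<noteq> b"
        using ab by (auto simp: A_def)
      then show False
        using ab rr(3) by (auto dest: antisymD)
    qed
    then show "(a, b) \<in> Restr w A"
      using ab by simp
  next
    fix a b assume ab: "(a, b) \<in> Restr w A"
    then have "(a, b) \<in> r"
      using rr(1) AB Br by (cases "a = b") (auto simp: A_def refl_on_def)
    then show "(a, b) \<in> Restr r A"
      using ab by simp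
  qed
  have WA: "Well_order (Restr w A)"
    by (rule Well_order_Restr[OF W])
  \<comment> \<open>Otherwise w would be isomorphic to a proper initial segment of the restriction,
    which sits inside a proper initial segment of w, too small for a cardinal.\<close>
  have "Restr w A \<le>o w"
  proof (rule ccontr)
    assume "\<not> Restr w A \<le>o w"
    then have "w <o Restr w A"
      using ordLess_or_ordLeq[OF W WA] by blast
    then obtain a where a: "a \<in> Field (Restr w A)"
      "w =o Restr (Restr w A) (underS (Restr w A) a)"
      using ordLess_iff_ordIso_Restr[OF WA W] by blast
    have "Field (Restr (Restr w A) (underS (Restr w A) a)) \<subseteq> underS w a"
      by (auto simp: Field_def underS_def)
    then have "|Field w| \<le>o |underS w a|"
      using card_of_cong[OF a(2)] card_of_mono1 ordIso_ordLeq_trans by blast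
    moreover have "a \<in> Field w"
      using a(1) by (auto simp: Field_def)
    then have "|underS w a| <o w"
      unfolding w_def by (intro card_of_underS card_of_Card_order)
    ultimately show False
      unfolding Fw using w_def not_ordLess_ordLeq by blast
  qed
  moreover have "cofinality r \<le>o Restr r A"
    using is_cofinality_cofinality[OF r] cof WA ordIso_reflexive[OF WA] eq
    unfolding is_cofinality_def by metis
  ultimately show ?thesis
    unfolding eq w_def using ordLeq_transitive by blast
qed

text \<open>A well-order on A is at least the cardinal of A. Together with the previous bound this
  reduces comparison of cofinalities to comparison of cardinalities of cofinal sets.\<close>

lemma ex_cofinal_card_of_le_cofinality:
  assumes r: "Linear_order r"
  shows "\<exists>A. cofinal_subset r A \<and> |A| \<le>o cofinality r"
proof -
  obtain A where A: "cofinal_subset r A" "cofinality r =o Restr r A"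
    using is_cofinality_cofinality[OF r] unfolding is_cofinality_def by blast
  have "Field (Restr r A) = A"
    using A(1) r by (intro Refl_Field_Restr2) (auto simp: cofinal_subset_def order_on_defs)
  moreover have "Well_order (Restr r A)"
    using A(2) by (simp add: ordIso_def)
  ultimately have "|A| \<le>o Restr r A"
    by (metis card_of_least)
  then show ?thesis
    using A ordIso_symmetric ordLeq_ordIso_trans by blast
qed

section \<open>Transport of cofinal sets between H and E\<close>

lemma germ_le_iexp: "germ_le f g \<Longrightarrow> germ_le ((germ_exp ^^ n) f) ((germ_exp ^^ n) g)"
proof (induction n)
  case (Suc n)
  have "germ_le u v \<Longrightarrow> germ_le (germ_exp u) (germ_exp v)" for u v
    by transfer simp
  with Suc show ?case by simp
qed simp

lemma germ_order_iff:
  assumes "hardy_field E" "f \<in> E" "g \<in> E"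
  shows "(f, g) \<in> germ_order E \<longleftrightarrow> germ_le f g"
proof
  assume "(f, g) \<in> germ_order E"
  then show "germ_le f g"
    using germ_less_imp_le germ_le_refl by (auto simp: germ_order_def)
next
  assume le: "germ_le f g"
  have "f = g" if "germ_le g f"
    using le that by transfer (erule (1) eventually_elim2, simp)
  then show "(f, g) \<in> germ_order E"
    using C_inf_subfield_linear[OF hardy_field_subfield[OF assms(1)] assms(2,3)] assms(2,3)
    by (auto simp: germ_order_def)
qed

lemma cofinal_germ_order_iff:
  assumes "hardy_field E"
  shows "cofinal_subset (germ_order E) A \<longleftrightarrow> A \<subseteq> E \<and> (\<forall>f\<in>E. \<exists>a\<in>A. germ_le f a)"
  using germ_order_iff[OF assms] unfolding cofinal_subset_def Field_germ_order by blast

text \<open>A finite set has an upper bound m in H, and \<open>m + 1\<close> escapes it. Infinity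
  guarantees that countably many iterates and the extra germ x do not raise the cardinality.\<close>

lemma infinite_cofinal:
  assumes H: "hardy_field H" and A: "cofinal_subset (germ_order H) A"
  shows "infinite A"
proof
  assume "finite A"
  have AH: "A \<subseteq> H" and cof: "\<And>f. f \<in> H \<Longrightarrow> \<exists>a\<in>A. germ_le f a"
    using A by (simp_all add: cofinal_germ_order_iff[OF H])
  have "\<exists>m\<in>H. \<forall>a\<in>A. germ_le a m"
    using \<open>finite A\<close> AH
  proof induction
    case empty
    then show ?case using hardy_field_closed(2)[OF H] by blast
  next
    case (insert a A)
    then obtain m where m: "m \<in> H" "\<forall>a\<in>A. germ_le a m"
      by auto
    have "germ_less a m \<or> germ_le m a"
      using C_inf_subfield_linear[OF hardy_field_subfield[OF H]] insert.prems m(1) by auto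
    then show ?case
    proof
      assume "germ_less a m"
      then show ?thesis using m germ_less_imp_le by blast
    next
      assume "germ_le m a"
      then show ?thesis using m(2) insert.prems germ_le_trans germ_le_refl by blast
    qed
  qed
  then obtain m where m: "m \<in> H" "\<And>a. a \<in> A \<Longrightarrow> germ_le a m"
    by blast
  obtain a where "a \<in> A" "germ_le (m + 1) a"
    using cof[OF hardy_field_closed(4)[OF H m(1) hardy_field_closed(3)[OF H]]] by blast
  then have "germ_le (m + 1) m"
    using m(2) germ_le_trans by blast
  then show False
    by transfer simp
qed

lemma iexp_bounded:
  assumes "hardy_field E" "germ_exp ` adjoin_x E \<subseteq> adjoin_x E" "h \<in> insert germ_x E"
  shows "\<exists>k\<in>E. germ_le ((germ_exp ^^ n) h) k"
  using cofinal_in_adjoin_x[OF assms(1,2) iexp_in_x_fractions[OF assms]] .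

theorem theorem2p14:
  fixes H E :: "germ set"
  assumes "hardy_field H"
    and "hardy_field E"
    and "H \<subseteq> E"
    and "diff_algebraic_over E H"
    and "germ_exp ` adjoin_x E \<subseteq> adjoin_x E"
  shows "cf E \<le>o cf H \<and> (germ_exp ` adjoin_x H \<subseteq> adjoin_x H \<longrightarrow> cf E =o cf H)"
proof -
  note H = assms(1) and E = assms(2)
  note growth = diff_algebraic_growth[OF H E assms(3,5,4)]
  note LH = Linear_order_germ_order[OF H] and LE = Linear_order_germ_order[OF E]
  obtain A where A: "cofinal_subset (germ_order H) A" "|A| \<le>o cf H"
    using ex_cofinal_card_of_le_cofinality[OF LH] unfolding cf_def by blast
  have AH: "A \<subseteq> H" and Acof: "\<And>f. f \<in> H \<Longrightarrow> \<exists>a\<in>A. germ_le f a"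
    using A(1) by (simp_all add: cofinal_germ_order_iff[OF H])
  have "\<forall>h n. \<exists>k. h \<in> insert germ_x E \<longrightarrow> k \<in> E \<and> germ_le ((germ_exp ^^ n) h) k"
    using iexp_bounded[OF E assms(5)] by blast
  then obtain k where k: "\<And>h n. h \<in> insert germ_x E \<Longrightarrow> k h n \<in> E"
    "\<And>h n. h \<in> insert germ_x E \<Longrightarrow> germ_le ((germ_exp ^^ n) h) (k h n)"
    by metis
  \<comment> \<open>An h in H can be replaced by a larger element of A, since iterated exponentials
    are monotone; the remaining case h = x is kept as it is.\<close>
  define C where "C = A \<union> {germ_x}"
  have CE: "C \<subseteq> insert germ_x E"
    using AH assms(3) by (auto simp: C_def)
  define B where "B = (\<lambda>(h, n). k h n) ` (C \<times> (UNIV :: nat set))"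
  have "\<exists>b\<in>B. germ_le f b" if f: "f \<in> E" for f
  proof -
    obtain h n where h: "h \<in> insert germ_x H" "germ_le f ((germ_exp ^^ n) h)"
      using growth[OF f] by blast
    obtain c where c: "c \<in> C" "germ_le h c"
      using h(1) Acof[of h] germ_le_refl by (auto simp: C_def)
    have "germ_le f (k c n)"
      using h(2) germ_le_iexp[OF c(2), of n] k(2)[of c n] c(1) CE germ_le_trans by blast
    then show ?thesis
      using c(1) by (auto simp: B_def)
  qed
  moreover have "B \<subseteq> E"
    using k(1) CE by (auto simp: B_def)
  ultimately have "cofinal_subset (germ_order E) B"
    by (simp add: cofinal_germ_order_iff[OF E])
  then have "cf E \<le>o |B|"
    unfolding cf_def by (rule cofinality_le_card_of[OF LE])
  also have "|B| \<le>o |C \<times> (UNIV :: nat set)|"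
    unfolding B_def by (rule card_of_image)
  also have "|C \<times> (UNIV :: nat set)| =o |C|"
  proof -
    have "infinite C"
      using infinite_cofinal[OF H A(1)] by (simp add: C_def)
    then show ?thesis
      using card_of_Times_infinite[of C "UNIV :: nat set"] infinite_iff_card_of_nat by blast
  qed
  also have "|C| \<le>o |A|"
  proof -
    have "infinite A"
      using infinite_cofinal[OF H A(1)] .
    moreover from this have "A \<noteq> {}"
      by auto
    ultimately show ?thesis
      unfolding C_def
      by (intro card_of_Un_ordLeq_infinite_Field)
        (simp_all add: Field_card_of card_of_refl ordIso_imp_ordLeq card_of_singl_ordLeq card_of_card_order_on)
  qed
  also note A(2)
  finally have le: "cf E \<le>o cf H" .
  \<comment> \<open>Now iterates starting from H and x are bounded in H itself, so each b in E has a
    bound \<open>u b\<close> in H. Since H is contained in E, the image under u of a cofinal subset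
    of E is cofinal in H.\<close>
  have "cf H \<le>o cf E" if ex: "germ_exp ` adjoin_x H \<subseteq> adjoin_x H"
  proof -
    obtain B where B: "cofinal_subset (germ_order E) B" "|B| \<le>o cf E"
      using ex_cofinal_card_of_le_cofinality[OF LE] unfolding cf_def by blast
    have BE: "B \<subseteq> E" and Bcof: "\<And>f. f \<in> E \<Longrightarrow> \<exists>b\<in>B. germ_le f b"
      using B(1) by (simp_all add: cofinal_germ_order_iff[OF E])
    have "\<exists>u. u \<in> H \<and> germ_le b u" if "b \<in> E" for b
      using growth[OF that] iexp_bounded[OF H ex] germ_le_trans by blast
    then obtain u where u: "\<And>b. b \<in> E \<Longrightarrow> u b \<in> H" "\<And>b. b \<in> E \<Longrightarrow> germ_le b (u b)"
      by metis
    have "\<exists>c\<in>u ` B. germ_le f c" if f: "f \<in> H" for f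
    proof -
      obtain b where "b \<in> B" "germ_le f b"
        using Bcof f assms(3) by blast
      then show ?thesis
        using u(2)[of b] BE germ_le_trans by blast
    qed
    moreover have "u ` B \<subseteq> H"
      using u(1) BE by blast
    ultimately have "cofinal_subset (germ_order H) (u ` B)"
      by (simp add: cofinal_germ_order_iff[OF H])
    then have "cf H \<le>o |u ` B|"
      unfolding cf_def by (rule cofinality_le_card_of[OF LH])
    also have "|u ` B| \<le>o |B|"
      by (rule card_of_image)
    also note B(2)
    finally show ?thesis .
  qed
  with le show ?thesis
    by (simp add: ordIso_iff_ordLeq)
qed

end
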